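(* Consider the hybrid AC/DC network dynamics described in the context, in closed loop with the secondary control scheme $$T_\xi\dot\xi=-\mathcal L\xi-\tilde Q\hat\omega,\qquad p^G=\tilde Q\xi,$$ together with, for every interlinking converter connecting an AC bus $i$ to a DC subsystem $k$, the converter control $\omega_i=m\bar V_k$, where $m>0$ is a constant. Consider an equilibrium point of this closed-loop system at which $|\eta^\ast_{ij}|<\frac{\pi}{2}$ for all $(i,j)\in E_{ac}$. Then there exists an open neighbourhood of this equilibrium point such that all solutions of the closed-loop system starting in this neighbourhood converge to a set of equilibria that satisfy $\omega^\ast=0$ and $\bar V^\ast=0$ and that solve the optimal power sharing problem, i.e. whose generation vector $p^{G\ast}$ is a solution of $$\min_{p^G}\ \tfrac12 (p^G)^TQp^G\quad\text{subject to}\quad \mathbf 1^Tp^G=\mathbf 1^Tp^L+\sum_{j\in N_{ac}\setminus X_{ac}}D_j\omega_j,\qquad p^G_j=0\ \ (j\in X_{ac}),$$ where the $\omega_j$ in the constraint are the equilibrium frequency deviations.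
   Context: Network. $N=\{1,\dots,|N|\}$ is a finite set of buses and $E$ a finite set of transmission lines, each given an arbitrary direction. The buses are partitioned as $N=N_{ac}\cup N_{dc}$ into AC and DC buses, where $N_{ac}$ is the disjoint union of the bus sets $N_i^{ac}$ of the AC subsystems and $N_{dc}$ the disjoint union of the bus sets $N_k^{dc}$ of the DC subsystems. Each subsystem, with its lines, is a connected graph. $E=E_{ac}\cup E_{dc}$, where $E_{ac}$ (resp. $E_{dc}$) are the lines inside AC (resp. DC) subsystems; there are no lines between different subsystems. Different subsystems are connected only through interlinking converters (ILCs), forming the set $X$; ILC $x\in X$ connects an AC bus $X_x^{ac}\in N_{ac}$ to a DC bus $X_x^{dc}\in N_{dc}$. The overall network (lines together with ILCs) is connected, and each bus hosts at most one ILC. Let $X_{ac}=\{X_x^{ac}:x\in X\}$ and $X_{dc}=\{X_x^{dc}:x\in X\}$. Variables and constants. $\omega_j$ ($j\in N_{ac}$) is the AC frequency deviation from nominal, $\eta_{ij}$ ($(i,j)\in E_{ac}$) the voltage angle difference between buses $i$ and $j$, $V_j$ ($j\in N_{dc}$) the DC voltage deviation from nominal, $p^G_j$ the generated power, $p^L_j$ the (constant) load, $p_{ij}$ the power transfer on line $(i,j)$, and $p^X_j$ the power leaving bus $j$ through the ILC. One has $p^X_j=0$ for $j\notin X_{ac}\cup X_{dc}$, and $p^X_{X_x^{dc}}=-p^X_{X_x^{ac}}$ for every $x\in X$ (instantaneous lossless converters). Also $p^G_j=0$ for $j\in X_{ac}$. Inertias $M_j>0$ and damping coefficients $D_j>0$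 ($j\in N_{ac}\setminus X_{ac}$), capacitances $C_j>0$ ($j\in N_{dc}$), AC line susceptances $B_{ij}>0$ and DC line conductances $G_{ij}>0$ are constants. Dynamics. $$\dot\eta_{ij}=\omega_i-\omega_j,\quad (i,j)\in E_{ac},$$ $$M_j\dot\omega_j=p^G_j-p^L_j+\sum_{i:i\to j}p_{ij}-\sum_{k:j\to k}p_{jk}-D_j\omega_j,\quad j\in N_{ac}\setminus X_{ac},$$ $$0=p^G_j-p^L_j+\sum_{i:i\to j}p_{ij}-\sum_{k:j\to k}p_{jk}-p^X_j,\quad j\in X_{ac},$$ $$C_j\dot V_j=p^G_j-p^L_j+\sum_{i:i\to j}p_{ij}-\sum_{k:j\to k}p_{jk}-p^X_j,\quad j\in N_{dc},$$ with $p_{ij}=B_{ij}\sin\eta_{ij}$ for $(i,j)\in E_{ac}$ and $p_{ij}=G_{ij}(V_i-V_j)$ for $(i,j)\in E_{dc}$. Here $i:i\to j$ and $k:j\to k$ range over predecessors and successors of $j$ in the directed graph $(N,E)$. Vectors. $\eta=[\eta_{ij}]_{(i,j)\in E_{ac}}$, $\omega=[\omega_j]_{j\in N_{ac}}$, $\omega^G=[\omega_j]_{j\in N_{ac}\setminus X_{ac}}$, $V=[V_j]_{j\in N_{dc}}$, $p^G=[p^G_j]_{j\in N}$, $p^L=[p^L_j]_{j\in N}$ (AC buses first, then DC buses). $\mathbf 1$ is the all-ones vector. Control data. $Q$ is a positive definite diagonal matrix of cost coefficients indexed by $N$; $\tilde Q$ is the diagonal matrix with $\tilde Q_{ii}=Q_{ii}^{-1}$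 for $i\in N\setminus X_{ac}$ and $\tilde Q_{ii}=0$ for $i\in X_{ac}$. For each DC subsystem $k$, the capacitance-weighted average voltage deviation is $\bar V_k=\sum_{j\in N_k^{dc}}C_jV_j$, and $\bar V$ is the vector of all $\bar V_k$. The virtual frequency deviation $\hat\omega=[\hat\omega_j]_{j\in N}$ is $\hat\omega_j=\omega_j$ if $j\in N_{ac}$ and $\hat\omega_j=m\bar V_k$ if $j\in N_k^{dc}$. $\xi=[\xi_j]_{j\in N}$ is a vector of communicated synchronizing variables, $T_\xi$ is a diagonal matrix of positive time constants, and $\mathcal L$ is the graph Laplacian of an undirected connected communication graph $(N,\tilde E)$ (i.e. $\mathcal L_{ii}=\deg(i)$, $\mathcal L_{ij}=-1$ if $(i,j)\in\tilde E$, and $0$ otherwise). Equilibrium. An equilibrium is a constant state $(\eta^\ast,\omega^{G\ast},V^\ast,\xi^\ast)$ (with corresponding constant values of the remaining variables) at which $$0=\omega_i-\omega_j,\quad (i,j)\in E_{ac},$$ $$0=p^G_j-p^L_j+\sum_{i:i\to j}p_{ij}-\sum_{k:j\to k}p_{jk}-D_j\omega_j,\quad j\in N_{ac}\setminus X_{ac},$$ $$0=p^G_j-p^L_j+\sum_{i:i\to j}p_{ij}-\sum_{k:j\to k}p_{jk}-p^X_j,\quad j\in X_{ac}\cup N_{dc},$$ $$0=-\mathcal L\xi-\tilde Q\hat\omega,$$ with $p_{ij}=B_{ij}\sin\eta_{ij}$ for $(i,j)\in E_{ac}$, $p_{ij}=G_{ij}(V_i-V_j)$ for $(i,j)\in E_{dc}$,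 $p^X_j=0$ for $j\notin X_{ac}\cup X_{dc}$, $p^X_{X_x^{dc}}=-p^X_{X_x^{ac}}$ for every $x\in X$, and with the control laws $p^G=\tilde Q\xi$ and $\omega_i=m\bar V_k$ for every ILC connecting an AC bus $i$ to a DC subsystem $k$; in particular the frequencies of all AC buses in a common AC subsystem coincide. Superscript $\ast$ denotes values at an equilibrium. *)

theory Defs
  imports "HOL-Analysis.Analysis"
begin

text \<open>
  The bus set is \<^term>\<open>UNIV\<close> of a finite type. A line \<open>(i, j)\<close> is directed from \<open>i\<close> to \<open>j\<close>, and an
  interlinking converter (ILC) is the pair \<open>(i, k)\<close> of its AC bus \<open>i\<close> and its DC bus \<open>k\<close>; this
  loses nothing because each bus hosts at most one ILC. A subsystem is identified with its bus
  set. Parameters given as functions are only relevant on the buses or lines to which they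
  belong.
\<close>

record 'n network =
  lines :: "('n \<times> 'n) set"
  ac_subs :: "'n set set"
  dc_subs :: "'n set set"
  ilcs :: "('n \<times> 'n) set"
  inertia :: "'n \<Rightarrow> real"
  damping :: "'n \<Rightarrow> real"
  capacitance :: "'n \<Rightarrow> real"
  susceptance :: "'n \<times> 'n \<Rightarrow> real"
  conductance :: "'n \<times> 'n \<Rightarrow> real"
  load :: "real ^ 'n"
  cost :: "real ^ 'n ^ 'n"
  time_const :: "real ^ 'n ^ 'n"
  comm :: "('n \<times> 'n) set"
  gain :: real

definition ac_buses :: "'n::finite network \<Rightarrow> 'n set" where
  "ac_buses net = \<Union>(ac_subs net)"

definition dc_buses :: "'n::finite network \<Rightarrow> 'n set" where
  "dc_buses net = \<Union>(dc_subs net)"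

definition ac_lines :: "'n::finite network \<Rightarrow> ('n \<times> 'n) set" where
  "ac_lines net = {(i, j) \<in> lines net. \<exists>S\<in>ac_subs net. i \<in> S \<and> j \<in> S}"

definition dc_lines :: "'n::finite network \<Rightarrow> ('n \<times> 'n) set" where
  "dc_lines net = {(i, j) \<in> lines net. \<exists>S\<in>dc_subs net. i \<in> S \<and> j \<in> S}"

definition x_ac :: "'n::finite network \<Rightarrow> 'n set" where
  "x_ac net = fst ` ilcs net"

definition x_dc :: "'n::finite network \<Rightarrow> 'n set" where
  "x_dc net = snd ` ilcs net"

definition gen_buses :: "'n::finite network \<Rightarrow> 'n set" where
  "gen_buses net = ac_buses net - x_ac net"

definition connected_graph :: "'a set \<Rightarrow> ('a \<times> 'a) set \<Rightarrow> bool" where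
  "connected_graph A R \<longleftrightarrow> (\<forall>i\<in>A. \<forall>j\<in>A. (i, j) \<in> ((R \<union> R\<inverse>) \<inter> A \<times> A)\<^sup>*)"

definition diagonal_matrix :: "real ^ 'n ^ 'n \<Rightarrow> bool" where
  "diagonal_matrix A \<longleftrightarrow> (\<forall>i j. i \<noteq> j \<longrightarrow> A $ i $ j = 0)"

definition positive_definite :: "real ^ 'n ^ 'n \<Rightarrow> bool" where
  "positive_definite A \<longleftrightarrow> transpose A = A \<and> (\<forall>v. v \<noteq> 0 \<longrightarrow> v \<bullet> (A *v v) > 0)"

definition laplacian :: "('n \<times> 'n) set \<Rightarrow> real ^ 'n ^ 'n" where
  "laplacian R = (\<chi> i j. if i = j then real (card {k. (i, k) \<in> R})
                         else if (i, j) \<in> R then - 1 else 0)"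

definition cost_inv :: "'n::finite network \<Rightarrow> real ^ 'n ^ 'n" where
  "cost_inv net = (\<chi> i j. if i = j \<and> i \<notin> x_ac net then inverse (cost net $ i $ i) else 0)"

text \<open>
  Nonemptiness of the set of AC subsystems is part of the network being a hybrid AC/DC network.
  It cannot be dropped: a single DC subsystem without any AC bus can oscillate undamped.
\<close>

definition hybrid_network :: "'n::finite network \<Rightarrow> bool" where
  "hybrid_network net \<longleftrightarrow>
     ac_subs net \<noteq> {} \<and>
     ac_buses net \<union> dc_buses net = UNIV \<and> ac_buses net \<inter> dc_buses net = {} \<and>
     partition_on (ac_buses net) (ac_subs net) \<and>
     partition_on (dc_buses net) (dc_subs net) \<and>
     lines net = ac_lines net \<union> dc_lines net \<and>
     (\<forall>S \<in> ac_subs net \<union> dc_subs net. connected_graph S (lines net)) \<and>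
     ilcs net \<subseteq> ac_buses net \<times> dc_buses net \<and>
     inj_on fst (ilcs net) \<and> inj_on snd (ilcs net) \<and>
     connected_graph UNIV (lines net \<union> ilcs net) \<and>
     (\<forall>j\<in>gen_buses net. inertia net j > 0 \<and> damping net j > 0) \<and>
     (\<forall>j\<in>dc_buses net. capacitance net j > 0) \<and>
     (\<forall>e\<in>ac_lines net. susceptance net e > 0) \<and>
     (\<forall>e\<in>dc_lines net. conductance net e > 0) \<and>
     diagonal_matrix (cost net) \<and> positive_definite (cost net) \<and>
     diagonal_matrix (time_const net) \<and> (\<forall>i. time_const net $ i $ i > 0) \<and>
     sym (comm net) \<and> irrefl (comm net) \<and> connected_graph UNIV (comm net) \<and>
     gain net > 0"

text \<open>
  Instantaneous values of all variables: angle differences on AC lines, frequency deviations of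
  AC buses, voltage deviations of DC buses, communicated variables, generation, and power
  leaving a bus through its ILC. Values of \<open>angle\<close>, \<open>freq\<close> and \<open>volt\<close> outside these lines and
  buses are never used.
\<close>

record 'n point =
  angle :: "'n \<times> 'n \<Rightarrow> real"
  freq :: "'n \<Rightarrow> real"
  volt :: "'n \<Rightarrow> real"
  sync :: "real ^ 'n"
  gen :: "real ^ 'n"
  conv :: "'n \<Rightarrow> real"

definition line_flow :: "'n::finite network \<Rightarrow> 'n point \<Rightarrow> 'n \<times> 'n \<Rightarrow> real" where
  "line_flow net v e =
     (if e \<in> ac_lines net then susceptance net e * sin (angle v e)
      else conductance net e * (volt v (fst e) - volt v (snd e)))"

definition net_power :: "'n::finite network \<Rightarrow> 'n point \<Rightarrow> 'n \<Rightarrow> real" where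
  "net_power net v j =
     gen v $ j - load net $ j + (\<Sum>i | (i, j) \<in> lines net. line_flow net v (i, j))
       - (\<Sum>k | (j, k) \<in> lines net. line_flow net v (j, k))"

definition avg_volt :: "'n::finite network \<Rightarrow> 'n point \<Rightarrow> 'n set \<Rightarrow> real" where
  "avg_volt net v S = (\<Sum>j\<in>S. capacitance net j * volt v j)"

definition dc_sub_of :: "'n::finite network \<Rightarrow> 'n \<Rightarrow> 'n set" where
  "dc_sub_of net j = (THE S. S \<in> dc_subs net \<and> j \<in> S)"

definition virtual_freq :: "'n::finite network \<Rightarrow> 'n point \<Rightarrow> real ^ 'n" where
  "virtual_freq net v = (\<chi> j. if j \<in> ac_buses net then freq v j
                              else gain net * avg_volt net v (dc_sub_of net j))"

definition sync_rate :: "'n::finite network \<Rightarrow> 'n point \<Rightarrow> real ^ 'n" where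
  "sync_rate net v = - (laplacian (comm net) *v sync v) - cost_inv net *v virtual_freq net v"

text \<open>
  The algebraic relations of the closed loop: lossless converters, no generation and power
  balance at the AC buses of ILCs, and the static control laws.
\<close>

definition algebraic_relations :: "'n::finite network \<Rightarrow> 'n point \<Rightarrow> bool" where
  "algebraic_relations net v \<longleftrightarrow>
     (\<forall>j. j \<notin> x_ac net \<union> x_dc net \<longrightarrow> conv v j = 0) \<and>
     (\<forall>(i, k) \<in> ilcs net. conv v k = - conv v i) \<and>
     (\<forall>j\<in>x_ac net. gen v $ j = 0) \<and>
     (\<forall>j\<in>x_ac net. 0 = net_power net v j - conv v j) \<and>
     gen v = cost_inv net *v sync v \<and>
     (\<forall>(i, k) \<in> ilcs net. \<forall>S\<in>dc_subs net. k \<in> S \<longrightarrow> freq v i = gain net * avg_volt net v S)"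

definition closed_loop_solution :: "'n::finite network \<Rightarrow> (real \<Rightarrow> 'n point) \<Rightarrow> bool" where
  "closed_loop_solution net v \<longleftrightarrow>
     (\<forall>t\<ge>0.
        algebraic_relations net (v t) \<and>
        (\<forall>(i, j) \<in> ac_lines net.
           ((\<lambda>s. angle (v s) (i, j)) has_real_derivative freq (v t) i - freq (v t) j)
             (at t within {0..})) \<and>
        (\<forall>j\<in>gen_buses net. \<exists>r.
           ((\<lambda>s. freq (v s) j) has_real_derivative r) (at t within {0..}) \<and>
           inertia net j * r = net_power net (v t) j - damping net j * freq (v t) j) \<and>
        (\<forall>j\<in>dc_buses net. \<exists>r.
           ((\<lambda>s. volt (v s) j) has_real_derivative r) (at t within {0..}) \<and>
           capacitance net j * r = net_power net (v t) j - conv (v t) j) \<and>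
        (\<exists>r. ((\<lambda>s. sync (v s)) has_vector_derivative r) (at t within {0..}) \<and>
           time_const net *v r = sync_rate net (v t)))"

definition equilibrium :: "'n::finite network \<Rightarrow> 'n point \<Rightarrow> bool" where
  "equilibrium net v \<longleftrightarrow>
     algebraic_relations net v \<and>
     (\<forall>(i, j) \<in> ac_lines net. 0 = freq v i - freq v j) \<and>
     (\<forall>j\<in>gen_buses net. 0 = net_power net v j - damping net j * freq v j) \<and>
     (\<forall>j\<in>dc_buses net. 0 = net_power net v j - conv v j) \<and>
     0 = sync_rate net v"

text \<open>
  The state consists of the angle differences of AC lines, the frequencies of AC buses without
  ILC, the DC voltages and the communicated variables. The spaces indexed by these lines and
  buses are embedded by zero padding, so \<open>state_space\<close> carries the Euclidean topology of the
  product of the four coordinate spaces.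
\<close>

type_synonym 'n state = "(real ^ ('n \<times> 'n)) \<times> (real ^ 'n) \<times> (real ^ 'n) \<times> (real ^ 'n)"

definition state_of :: "'n::finite network \<Rightarrow> 'n point \<Rightarrow> 'n state" where
  "state_of net v =
     (\<chi> e. if e \<in> ac_lines net then angle v e else 0,
      \<chi> j. if j \<in> gen_buses net then freq v j else 0,
      \<chi> j. if j \<in> dc_buses net then volt v j else 0,
      sync v)"

definition state_space :: "'n::finite network \<Rightarrow> 'n state set" where
  "state_space net = range (state_of net)"

definition feasible_generation ::
    "'n::finite network \<Rightarrow> ('n \<Rightarrow> real) \<Rightarrow> real ^ 'n \<Rightarrow> bool" where
  "feasible_generation net w p \<longleftrightarrow>
     1 \<bullet> p = 1 \<bullet> load net + (\<Sum>j\<in>gen_buses net. damping net j * w j) \<and>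
     (\<forall>j\<in>x_ac net. p $ j = 0)"

definition optimal_power_sharing ::
    "'n::finite network \<Rightarrow> ('n \<Rightarrow> real) \<Rightarrow> real ^ 'n \<Rightarrow> bool" where
  "optimal_power_sharing net w p \<longleftrightarrow>
     is_arg_min (\<lambda>q. 1 / 2 * (q \<bullet> (cost net *v q))) (feasible_generation net w) p"

end

theory Submission
  imports Defs
begin

text \<open>
  At an equilibrium the virtual frequency is constant on the connected network and orthogonal to
  the positive reciprocal costs, so it vanishes. The communicated variables are then all equal,
  which is the optimality condition, and hence every equilibrium is optimal.

  The kinetic energy, the Bregman distance of the angles, the squared average voltages
  and the squared deviation of the communicated variables form a Lyapunov function whose
  derivative is \<open>- \<Sum> D \<omega>\<^sup>2 - \<xi> \<bullet> L \<xi>\<close>. It sees the voltages only through the averages, so the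
  neighbourhood restricts the angles to a potential well but leaves the individual voltages free;
  these are controlled separately by the dissipation in the DC lines.

  LaSalle's principle is replaced by Barbalat's lemma: applied successively to the Lyapunov
  function, the differences of the communicated variables, the frequencies and the voltages, it
  shows that all rates along a trapped solution tend to zero. The solution is bounded, and all its
  cluster points are equilibria.
\<close>

subsection \<open>Asymptotics of functions on the half line\<close>

text \<open>Barbalat's lemma works with one solution at a time, whereas LaSalle's principle needs a
  flow and the invariance of its limit sets. \<open>closed_loop_solution\<close> provides only
  functions on \<open>{0..}\<close>, with one-sided derivatives at time 0, that satisfy differential
  and algebraic relations.

  The obstacle is that the angles are not known to converge: cycles of AC lines allow continua of
  equilibria, and the Lyapunov function yields only boundedness. Barbalat's lemma is therefore based
  on \<open>slowly_varying\<close>, which asks that increments over each fixed step vanish at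
  infinity. This follows from vanishing rates, survives linear combinations and the sine, and passes
  through the linear DC dynamics.

  The order of the estimates matters. Only the frequencies of \<open>gen_buses\<close> and the
  disagreement of the communicated variables are dissipated, so the average voltages must be reached
  through the communication dynamics. Converter powers are expressed by AC quantities, so the inputs
  of the DC subsystems are controlled before the voltages are known to be bounded.\<close>

lemma field_mvt_half_line:
  fixes f :: "real \<Rightarrow> real"
  assumes "\<And>t. t \<ge> 0 \<Longrightarrow> (f has_real_derivative f' t) (at t within {0..})"
    and "0 \<le> a" "a < b"
  obtains c where "a < c" "c < b" "f b - f a = f' c * (b - a)"
proof -
  have "\<exists>x\<in>{a<..<b}. f b - f a = (\<lambda>h. f' x * h) (b - a)"
  proof (rule mvt_simple[OF assms(3)])
    fix x assume "a \<le> x" "x \<le> b"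
    then have "(f has_real_derivative f' x) (at x within {a..b})"
      using assms by (auto intro: has_field_derivative_subset[where s="{0..}"])
    then show "(f has_derivative (\<lambda>h. f' x * h)) (at x within {a..b})"
      by (simp add: has_field_derivative_def)
  qed
  then show ?thesis using that by auto
qed

lemma decreasing_half_line:
  fixes f :: "real \<Rightarrow> real"
  assumes "\<And>t. t \<ge> 0 \<Longrightarrow> (f has_real_derivative f' t) (at t within {0..})"
    and "\<And>t. t \<ge> T \<Longrightarrow> f' t \<le> 0" and "0 \<le> T" "T \<le> s" "s \<le> t"
  shows "f t \<le> f s"
proof (cases "s = t")
  case False
  then obtain c where "s < c" "c < t" "f t - f s = f' c * (t - s)"
    using field_mvt_half_line[OF assms(1), of s t] assms(3-5) by (metis order_trans order_le_imp_less_or_eq)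
  then show ?thesis
    using assms(2)[of c] assms False mult_nonpos_nonneg[of "f' c" "t - s"] by linarith
qed simp

section \<open>Bounded Lipschitz functions, the regularity required of rates\<close>

definition bounded_lipschitz :: "(real \<Rightarrow> real) \<Rightarrow> bool" where
  "bounded_lipschitz f \<longleftrightarrow>
     (\<exists>K\<ge>0. \<forall>t\<ge>0. \<bar>f t\<bar> \<le> K \<and> (\<forall>s\<ge>0. \<bar>f s - f t\<bar> \<le> K * \<bar>s - t\<bar>))"

lemma bounded_lipschitzI:
  assumes "\<And>t. t \<ge> 0 \<Longrightarrow> \<bar>f t\<bar> \<le> K"
    and "\<And>s t. s \<ge> 0 \<Longrightarrow> t \<ge> 0 \<Longrightarrow> \<bar>f s - f t\<bar> \<le> L * \<bar>s - t\<bar>"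
  shows "bounded_lipschitz f"
proof -
  define M where "M = max (max 0 K) L"
  have M: "M \<ge> 0" "M \<ge> K" "M \<ge> L" by (auto simp: M_def)
  have "\<bar>f s - f t\<bar> \<le> M * \<bar>s - t\<bar>" if "s \<ge> 0" "t \<ge> 0" for s t
    using assms(2)[OF that] mult_right_mono[OF M(3), of "\<bar>s - t\<bar>"] by simp
  moreover have "\<bar>f t\<bar> \<le> M" if "t \<ge> 0" for t
    using assms(1)[OF that] M by simp
  ultimately show ?thesis unfolding bounded_lipschitz_def using M(1) by blast
qed

lemma bounded_lipschitzE:
  assumes "bounded_lipschitz f"
  obtains K where "K \<ge> 0" "\<And>t. t \<ge> 0 \<Longrightarrow> \<bar>f t\<bar> \<le> K"
    "\<And>s t. s \<ge> 0 \<Longrightarrow> t \<ge> 0 \<Longrightarrow> \<bar>f s - f t\<bar> \<le> K * \<bar>s - t\<bar>"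
  using assms unfolding bounded_lipschitz_def by blast

lemma bounded_lipschitz_const [simp]: "bounded_lipschitz (\<lambda>t. c)"
  by (rule bounded_lipschitzI[where K="\<bar>c\<bar>" and L=0]) auto

lemma bounded_lipschitz_add:
  assumes "bounded_lipschitz f" "bounded_lipschitz g"
  shows "bounded_lipschitz (\<lambda>t. f t + g t)"
proof -
  obtain K where "K \<ge> 0" and K: "\<And>t. t \<ge> 0 \<Longrightarrow> \<bar>f t\<bar> \<le> K"
      "\<And>s t. s \<ge> 0 \<Longrightarrow> t \<ge> 0 \<Longrightarrow> \<bar>f s - f t\<bar> \<le> K * \<bar>s - t\<bar>"
    using bounded_lipschitzE[OF assms(1)] by metis
  obtain L where "L \<ge> 0" and L: "\<And>t. t \<ge> 0 \<Longrightarrow> \<bar>g t\<bar> \<le> L"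
      "\<And>s t. s \<ge> 0 \<Longrightarrow> t \<ge> 0 \<Longrightarrow> \<bar>g s - g t\<bar> \<le> L * \<bar>s - t\<bar>"
    using bounded_lipschitzE[OF assms(2)] by metis
  show ?thesis
  proof (rule bounded_lipschitzI)
    show "\<bar>f t + g t\<bar> \<le> K + L" if "t \<ge> 0" for t
      using K(1)[OF that] L(1)[OF that] by linarith
    show "\<bar>f s + g s - (f t + g t)\<bar> \<le> (K + L) * \<bar>s - t\<bar>" if "s \<ge> 0" "t \<ge> 0" for s t
      using K(2)[OF that] L(2)[OF that] by (simp add: distrib_right)
  qed
qed

text \<open>Products are the reason why boundedness is part of the notion: each factor's increment
  is multiplied by the size of the other factor.\<close>

lemma bounded_lipschitz_mult:
  assumes "bounded_lipschitz f" "bounded_lipschitz g"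
  shows "bounded_lipschitz (\<lambda>t. f t * g t)"
proof -
  obtain K where "K \<ge> 0" and K: "\<And>t. t \<ge> 0 \<Longrightarrow> \<bar>f t\<bar> \<le> K"
      "\<And>s t. s \<ge> 0 \<Longrightarrow> t \<ge> 0 \<Longrightarrow> \<bar>f s - f t\<bar> \<le> K * \<bar>s - t\<bar>"
    using bounded_lipschitzE[OF assms(1)] by metis
  obtain L where "L \<ge> 0" and L: "\<And>t. t \<ge> 0 \<Longrightarrow> \<bar>g t\<bar> \<le> L"
      "\<And>s t. s \<ge> 0 \<Longrightarrow> t \<ge> 0 \<Longrightarrow> \<bar>g s - g t\<bar> \<le> L * \<bar>s - t\<bar>"
    using bounded_lipschitzE[OF assms(2)] by metis
  show ?thesis
  proof (rule bounded_lipschitzI)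
    show "\<bar>f t * g t\<bar> \<le> K * L" if "t \<ge> 0" for t
      using K(1)[OF that] L(1)[OF that] \<open>K \<ge> 0\<close> by (simp add: abs_mult mult_mono)
    show "\<bar>f s * g s - f t * g t\<bar> \<le> (2 * K * L) * \<bar>s - t\<bar>" if "s \<ge> 0" "t \<ge> 0" for s t
    proof -
      have "f s * g s - f t * g t = (f s - f t) * g s + f t * (g s - g t)"
        by (simp add: algebra_simps)
      then have "\<bar>f s * g s - f t * g t\<bar> \<le> \<bar>f s - f t\<bar> * \<bar>g s\<bar> + \<bar>f t\<bar> * \<bar>g s - g t\<bar>"
        by (metis abs_mult abs_triangle_ineq)
      also have "\<dots> \<le> (K * \<bar>s - t\<bar>) * L + K * (L * \<bar>s - t\<bar>)"
        using K L that \<open>K \<ge> 0\<close> by (intro add_mono mult_mono) auto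
      finally show ?thesis by (simp add: algebra_simps)
    qed
  qed
qed

lemma bounded_lipschitz_uminus:
  assumes "bounded_lipschitz f" shows "bounded_lipschitz (\<lambda>t. - f t)"
  using bounded_lipschitz_mult[OF bounded_lipschitz_const[of "-1"] assms] by simp

lemma bounded_lipschitz_diff:
  assumes "bounded_lipschitz f" "bounded_lipschitz g"
  shows "bounded_lipschitz (\<lambda>t. f t - g t)"
  using bounded_lipschitz_add[OF assms(1) bounded_lipschitz_uminus[OF assms(2)]] by simp

lemma bounded_lipschitz_sum:
  assumes "\<And>i. i \<in> I \<Longrightarrow> bounded_lipschitz (f i)"
  shows "bounded_lipschitz (\<lambda>t. \<Sum>i\<in>I. f i t)"
  using assms by (induction I rule: infinite_finite_induct) (auto intro: bounded_lipschitz_add)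

lemma abs_sin_diff_le: "\<bar>sin x - sin y\<bar> \<le> \<bar>x - y\<bar>" for x y :: real
proof -
  have "\<bar>sin x - sin y\<bar> = 2 * \<bar>sin ((x - y) / 2)\<bar> * \<bar>cos ((x + y) / 2)\<bar>"
    by (simp add: sin_diff_sin abs_mult)
  also have "\<dots> \<le> 2 * \<bar>(x - y) / 2\<bar> * 1"
    by (intro mult_mono abs_sin_x_le_abs_x) (auto simp del: abs_divide)
  finally show ?thesis by simp
qed

lemma bounded_lipschitz_sin:
  assumes "bounded_lipschitz f" shows "bounded_lipschitz (\<lambda>t. sin (f t))"
proof -
  obtain K where "\<And>s t. s \<ge> 0 \<Longrightarrow> t \<ge> 0 \<Longrightarrow> \<bar>f s - f t\<bar> \<le> K * \<bar>s - t\<bar>"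
    using bounded_lipschitzE[OF assms] by metis
  then show ?thesis
    by (intro bounded_lipschitzI[where K=1 and L=K]) (auto intro: order_trans[OF abs_sin_diff_le])
qed

lemma bounded_lipschitz_cong:
  assumes "\<And>t. t \<ge> 0 \<Longrightarrow> f t = g t"
  shows "bounded_lipschitz f \<longleftrightarrow> bounded_lipschitz g"
  unfolding bounded_lipschitz_def using assms by simp

lemmas bounded_lipschitz_intros =
  bounded_lipschitz_const bounded_lipschitz_add bounded_lipschitz_diff bounded_lipschitz_mult
  bounded_lipschitz_uminus bounded_lipschitz_sum bounded_lipschitz_sin

lemma bounded_lipschitz_of_derivative:
  fixes f :: "real \<Rightarrow> real"
  assumes "\<And>t. t \<ge> 0 \<Longrightarrow> (f has_real_derivative f' t) (at t within {0..})"
    and "\<And>t. t \<ge> 0 \<Longrightarrow> \<bar>f t\<bar> \<le> K" and "\<And>t. t \<ge> 0 \<Longrightarrow> \<bar>f' t\<bar> \<le> L"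
  shows "bounded_lipschitz f"
proof (rule bounded_lipschitzI[OF assms(2)])
  have *: "\<bar>f b - f a\<bar> \<le> L * \<bar>b - a\<bar>" if ab: "0 \<le> a" "a < b" for a b
  proof -
    obtain c where "a < c" "c < b" "f b - f a = f' c * (b - a)"
      using field_mvt_half_line[OF assms(1) ab] by metis
    then show ?thesis using assms(3)[of c] ab by (simp add: abs_mult mult_right_mono)
  qed
  show "\<bar>f s - f t\<bar> \<le> L * \<bar>s - t\<bar>" if "s \<ge> 0" "t \<ge> 0" for s t
    using *[of s t] *[of t s] that by (cases s t rule: linorder_cases) (auto simp: abs_minus_commute)
qed

section \<open>Functions whose increments over fixed steps vanish at infinity\<close>

definition slowly_varying :: "(real \<Rightarrow> real) \<Rightarrow> bool" where
  "slowly_varying f \<longleftrightarrow> (\<forall>h>0. ((\<lambda>t. f (t + h) - f t) \<longlongrightarrow> 0) at_top)"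

lemma filterlim_shift: "filterlim (\<lambda>t. t + h :: real) at_top at_top"
  using filterlim_tendsto_add_at_top[OF tendsto_const filterlim_ident, of h] by (simp add: add.commute)

lemma slowly_varying_tendsto:
  assumes "(f \<longlongrightarrow> L) at_top" shows "slowly_varying f"
  unfolding slowly_varying_def
proof (intro allI impI)
  fix h :: real
  have "((\<lambda>t. f (t + h)) \<longlongrightarrow> L) at_top"
    using assms by (rule filterlim_compose[OF _ filterlim_shift])
  from tendsto_diff[OF this assms] show "((\<lambda>t. f (t + h) - f t) \<longlongrightarrow> 0) at_top" by simp
qed

lemma slowly_varying_const [simp]: "slowly_varying (\<lambda>t. c)"
  by (simp add: slowly_varying_def)

lemma slowly_varying_add:
  assumes "slowly_varying f" "slowly_varying g" shows "slowly_varying (\<lambda>t. f t + g t)"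
  unfolding slowly_varying_def
proof (intro allI impI)
  fix h :: real assume "h > 0"
  then have "((\<lambda>t. (f (t + h) - f t) + (g (t + h) - g t)) \<longlongrightarrow> 0 + 0) at_top"
    using assms unfolding slowly_varying_def by (intro tendsto_add) auto
  then show "((\<lambda>t. f (t + h) + g (t + h) - (f t + g t)) \<longlongrightarrow> 0) at_top"
    by (simp add: algebra_simps)
qed

lemma slowly_varying_cmult:
  assumes "slowly_varying f" shows "slowly_varying (\<lambda>t. c * f t)"
  using assms unfolding slowly_varying_def
  by (auto simp: right_diff_distrib[symmetric] intro: tendsto_mult_right_zero)

lemma slowly_varying_diff:
  assumes "slowly_varying f" "slowly_varying g" shows "slowly_varying (\<lambda>t. f t - g t)"
  using slowly_varying_add[OF assms(1) slowly_varying_cmult[OF assms(2), of "-1"]] by simp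

lemma slowly_varying_uminus:
  assumes "slowly_varying f" shows "slowly_varying (\<lambda>t. - f t)"
  using slowly_varying_cmult[OF assms, of "-1"] by simp

lemma slowly_varying_sum:
  assumes "\<And>i. i \<in> I \<Longrightarrow> slowly_varying (f i)"
  shows "slowly_varying (\<lambda>t. \<Sum>i\<in>I. f i t)"
  using assms by (induction I rule: infinite_finite_induct) (auto intro: slowly_varying_add)

lemma slowly_varying_sin:
  assumes "slowly_varying f" shows "slowly_varying (\<lambda>t. sin (f t))"
  unfolding slowly_varying_def
proof (intro allI impI)
  fix h :: real assume "h > 0"
  then have "((\<lambda>t. f (t + h) - f t) \<longlongrightarrow> 0) at_top"
    using assms by (auto simp: slowly_varying_def)
  then show "((\<lambda>t. sin (f (t + h)) - sin (f t)) \<longlongrightarrow> 0) at_top"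
    by (rule Lim_null_comparison[rotated, OF tendsto_rabs_zero]) (simp add: abs_sin_diff_le)
qed

lemma slowly_varying_cong:
  assumes "\<And>t. t \<ge> 0 \<Longrightarrow> f t = g t"
  shows "slowly_varying f \<longleftrightarrow> slowly_varying g"
proof -
  have "((\<lambda>t. f (t + h) - f t) \<longlongrightarrow> 0) at_top \<longleftrightarrow> ((\<lambda>t. g (t + h) - g t) \<longlongrightarrow> 0) at_top"
    if "h > 0" for h
    using assms that by (intro filterlim_cong eventually_mono[OF eventually_ge_at_top[of 0]]) auto
  then show ?thesis unfolding slowly_varying_def by blast
qed

lemmas slowly_varying_intros =
  slowly_varying_const slowly_varying_add slowly_varying_diff slowly_varying_cmult
  slowly_varying_uminus slowly_varying_sum slowly_varying_sin

lemma slowly_varying_of_derivative: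
  fixes f :: "real \<Rightarrow> real"
  assumes "\<And>t. t \<ge> 0 \<Longrightarrow> (f has_real_derivative f' t) (at t within {0..})"
    and "(f' \<longlongrightarrow> 0) at_top"
  shows "slowly_varying f"
  unfolding slowly_varying_def
proof (intro allI impI tendstoI)
  fix h e :: real assume "h > 0" "e > 0"
  then have "\<forall>\<^sub>F t in at_top. dist (f' t) 0 < e / h"
    using assms(2) by (intro tendstoD) auto
  then obtain T where T: "\<And>t. t \<ge> T \<Longrightarrow> \<bar>f' t\<bar> < e / h"
    by (auto simp: eventually_at_top_linorder)
  have "\<bar>f (t + h) - f t\<bar> < e" if t: "t \<ge> max 0 T" for t
  proof -
    obtain c where c: "t < c" "c < t + h" "f (t + h) - f t = f' c * (t + h - t)"
      using field_mvt_half_line[OF assms(1), of t "t + h"] t \<open>h > 0\<close> by auto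
    then have "\<bar>f' c\<bar> * h < e / h * h"
      using T[of c] t \<open>h > 0\<close> by (intro mult_strict_right_mono) auto
    then show ?thesis using c \<open>h > 0\<close> by (simp add: abs_mult)
  qed
  then show "\<forall>\<^sub>F t in at_top. dist (f (t + h) - f t) 0 < e"
    unfolding eventually_at_top_linorder by (auto intro!: exI[of _ "max 0 T"])
qed

text \<open>
  A variant of Barbalat's lemma: \<open>f' t\<close> differs from the difference quotient of step \<open>h\<close> by
  \<open>O(h)\<close> uniformly in \<open>t\<close>, and the difference quotient vanishes at infinity for each \<open>h\<close>.
\<close>

lemma barbalat:
  fixes f :: "real \<Rightarrow> real"
  assumes "\<And>t. t \<ge> 0 \<Longrightarrow> (f has_real_derivative f' t) (at t within {0..})"
    and "bounded_lipschitz f'" and "slowly_varying f"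
  shows "(f' \<longlongrightarrow> 0) at_top"
proof (rule tendstoI)
  fix e :: real assume "e > 0"
  obtain K where "K \<ge> 0" and K: "\<And>s t. s \<ge> 0 \<Longrightarrow> t \<ge> 0 \<Longrightarrow> \<bar>f' s - f' t\<bar> \<le> K * \<bar>s - t\<bar>"
    using bounded_lipschitzE[OF assms(2)] by metis
  \<comment> \<open>The step is so short that \<open>f'\<close> changes by at most
    \<open>K * h \<le> e / 2\<close> within it; the other half of \<open>e\<close> is left to the
    difference quotient. \<open>K + 1\<close> keeps the denominator positive when
    \<open>K = 0\<close>.\<close>
  define h where "h = e / (2 * (K + 1))"
  have "h > 0" using \<open>e > 0\<close> \<open>K \<ge> 0\<close> by (simp add: h_def)
  have "K * h \<le> (K + 1) * h" using \<open>h > 0\<close> by simp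
  also have "\<dots> = e / 2" using \<open>K \<ge> 0\<close> by (simp add: h_def field_simps)
  finally have Kh: "K * h \<le> e / 2" .
  have "\<forall>\<^sub>F t in at_top. dist (f (t + h) - f t) 0 < h * e / 2"
    using assms(3) \<open>h > 0\<close> \<open>e > 0\<close> by (intro tendstoD) (auto simp: slowly_varying_def)
  then show "\<forall>\<^sub>F t in at_top. dist (f' t) 0 < e"
    using eventually_ge_at_top[of 0]
  proof eventually_elim
    case (elim t)
    obtain c where c: "t < c" "c < t + h" "f (t + h) - f t = f' c * (t + h - t)"
      using field_mvt_half_line[OF assms(1), of t "t + h"] elim \<open>h > 0\<close> by auto
    have "\<bar>f' c\<bar> * h < (e / 2) * h"
      using elim(1) c \<open>h > 0\<close> by (simp add: abs_mult mult.commute)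
    then have "\<bar>f' c\<bar> < e / 2" using \<open>h > 0\<close> by (simp only: mult_less_cancel_right_pos)
    moreover have "\<bar>f' c - f' t\<bar> \<le> K * h"
      using K[of c t] c elim mult_left_mono[of "\<bar>c - t\<bar>" h K] \<open>K \<ge> 0\<close> by linarith
    ultimately show ?case using Kh by simp
  qed
qed

lemma decreasing_bounded_below_tendsto:
  fixes f :: "real \<Rightarrow> real"
  assumes "\<And>s t. 0 \<le> s \<Longrightarrow> s \<le> t \<Longrightarrow> f t \<le> f s" and "\<And>t. t \<ge> 0 \<Longrightarrow> B \<le> f t"
  obtains L where "(f \<longlongrightarrow> L) at_top"
proof
  define L where "L = Inf (f ` {0..})"
  have bdd: "bdd_below (f ` {0..})" using assms(2) by (intro bdd_belowI2[of _ B]) auto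
  show "(f \<longlongrightarrow> L) at_top"
  proof (rule tendstoI)
    fix e :: real assume "e > 0"
    then obtain T where T: "T \<ge> 0" "f T < L + e"
      using cInf_lessD[of "f ` {0..}" "L + e"] by (auto simp: L_def)
    have "dist (f t) L < e" if "t \<ge> T" for t
      using assms(1)[OF T(1) that] T cInf_lower[OF _ bdd, of "f t"] that
      by (auto simp: dist_real_def L_def)
    then show "\<forall>\<^sub>F t in at_top. dist (f t) L < e"
      unfolding eventually_at_top_linorder by blast
  qed
qed

section \<open>Linear differential inequalities\<close>

lemma linear_decay_bound:
  fixes f :: "real \<Rightarrow> real"
  assumes f: "\<And>t. t \<ge> 0 \<Longrightarrow> (f has_real_derivative f' t) (at t within {0..})"
    and le: "\<And>t. t \<ge> T \<Longrightarrow> f' t \<le> - a * f t + K" and "a > 0" "0 \<le> T" "T \<le> t"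
  shows "f t \<le> K / a + \<bar>f T - K / a\<bar> * exp (- a * (t - T))"
proof -
  \<comment> \<open>Integrating factor: \<open>K / a\<close> is the rest point of
    \<open>f' = - a * f + K\<close>, so the deviation from it, scaled by \<open>exp (a * t)\<close>,
    cannot increase.\<close>
  define F where "F t = (f t - K / a) * exp (a * t)" for t
  have "(F has_real_derivative (f' t + a * f t - K) * exp (a * t)) (at t within {0..})"
    if "t \<ge> 0" for t
    unfolding F_def using \<open>a > 0\<close>
    by (auto intro!: derivative_eq_intros f[OF that] simp: field_simps)
  moreover have "(f' t + a * f t - K) * exp (a * t) \<le> 0" if "t \<ge> T" for t
    using le[OF that] by (simp add: mult_nonpos_nonneg)
  ultimately have "F t \<le> F T"
    using assms decreasing_half_line[of F "\<lambda>t. (f' t + a * f t - K) * exp (a * t)" T T t]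
    by auto
  then have "(f t - K / a) * exp (a * t) * exp (- a * t) \<le> (f T - K / a) * exp (a * T) * exp (- a * t)"
    unfolding F_def by (intro mult_right_mono) auto
  then have "f t - K / a \<le> (f T - K / a) * exp (- a * (t - T))"
    by (simp add: mult.assoc exp_add[symmetric] algebra_simps)
  also have "\<dots> \<le> \<bar>f T - K / a\<bar> * exp (- a * (t - T))"
    by (intro mult_right_mono) auto
  finally show ?thesis by simp
qed

lemma linear_decay_bounded:
  fixes f :: "real \<Rightarrow> real"
  assumes "\<And>t. t \<ge> 0 \<Longrightarrow> (f has_real_derivative f' t) (at t within {0..})"
    and "\<And>t. t \<ge> 0 \<Longrightarrow> f' t \<le> - a * f t + g t" and "a > 0"
    and "\<And>t. t \<ge> 0 \<Longrightarrow> g t \<le> K"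
  obtains B where "\<And>t. t \<ge> 0 \<Longrightarrow> f t \<le> B"
proof
  fix t :: real assume "t \<ge> 0"
  have "f' t \<le> - a * f t + K" if "t \<ge> 0" for t
    using assms(2,4)[OF that] by linarith
  then have "f t \<le> K / a + \<bar>f 0 - K / a\<bar> * exp (- a * (t - 0))"
    using linear_decay_bound[OF assms(1), of 0 a K t] \<open>a > 0\<close> \<open>t \<ge> 0\<close> by blast
  also have "\<dots> \<le> K / a + \<bar>f 0 - K / a\<bar> * 1"
    using \<open>a > 0\<close> \<open>t \<ge> 0\<close> by (intro add_left_mono mult_left_mono) auto
  finally show "f t \<le> K / a + \<bar>f 0 - K / a\<bar> * 1" .
qed

lemma linear_decay_tendsto:
  fixes f :: "real \<Rightarrow> real"
  assumes f: "\<And>t. t \<ge> 0 \<Longrightarrow> (f has_real_derivative f' t) (at t within {0..})"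
    and le: "\<And>t. t \<ge> 0 \<Longrightarrow> f' t \<le> - a * f t + g t" and "a > 0"
    and nonneg: "\<And>t. t \<ge> 0 \<Longrightarrow> f t \<ge> 0" and g: "(g \<longlongrightarrow> 0) at_top"
  shows "(f \<longlongrightarrow> 0) at_top"
proof (rule tendstoI)
  fix e :: real assume "e > 0"
  \<comment> \<open>The bound restarted at a time after which \<open>g \<le> K\<close> settles at
    \<open>K / a = e / 2\<close>; the decaying exponential receives the other half of
    \<open>e\<close>.\<close>
  define K where "K = a * e / 2"
  have "K > 0" using \<open>e > 0\<close> \<open>a > 0\<close> by (simp add: K_def)
  have "\<forall>\<^sub>F t in at_top. dist (g t) 0 < K" using g \<open>K > 0\<close> by (rule tendstoD)
  then obtain T0 where T0: "\<And>t. t \<ge> T0 \<Longrightarrow> g t \<le> K"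
    by (force simp: eventually_at_top_linorder)
  define T where "T = max 0 T0"
  have "T \<ge> 0" by (simp add: T_def)
  have "f' t \<le> - a * f t + K" if "t \<ge> T" for t
    using le[of t] T0[of t] that by (simp add: T_def)
  then have bound: "f t \<le> e / 2 + \<bar>f T - e / 2\<bar> * exp (- a * (t - T))" if "t \<ge> T" for t
    using linear_decay_bound[OF f, of T a K t] \<open>a > 0\<close> \<open>T \<ge> 0\<close> that by (simp add: K_def)
  have "filterlim (\<lambda>t. t + (- T)) at_top at_top" by (rule filterlim_shift)
  then have "filterlim (\<lambda>t. - a * (t + (- T))) at_bot at_top"
    using \<open>a > 0\<close> by (intro filterlim_tendsto_neg_mult_at_bot[OF tendsto_const]) auto
  then have "((\<lambda>t. exp (- a * (t + (- T)))) \<longlongrightarrow> 0) at_top"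
    by (rule filterlim_compose[OF exp_at_bot])
  then have "((\<lambda>t. \<bar>f T - e / 2\<bar> * exp (- a * (t - T))) \<longlongrightarrow> 0) at_top"
    by (intro tendsto_mult_right_zero) simp
  then have "\<forall>\<^sub>F t in at_top. dist (\<bar>f T - e / 2\<bar> * exp (- a * (t - T))) 0 < e / 2"
    using \<open>e > 0\<close> by (intro tendstoD) auto
  then show "\<forall>\<^sub>F t in at_top. dist (f t) 0 < e"
    using eventually_ge_at_top[of T]
  proof eventually_elim
    case (elim t)
    then show ?case
      using bound[of t] nonneg[of t] \<open>T \<ge> 0\<close> by auto
  qed
qed

section \<open>Boundedness on the half line\<close>

definition bounded_half_line :: "(real \<Rightarrow> real) \<Rightarrow> bool" where
  "bounded_half_line f \<longleftrightarrow> (\<exists>K. \<forall>t\<ge>0. \<bar>f t\<bar> \<le> K)"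

lemma bounded_half_lineI: "(\<And>t. t \<ge> 0 \<Longrightarrow> \<bar>f t\<bar> \<le> K) \<Longrightarrow> bounded_half_line f"
  by (auto simp: bounded_half_line_def)

lemma bounded_half_line_const [simp]: "bounded_half_line (\<lambda>t. c)"
  by (auto simp: bounded_half_line_def)

lemma bounded_half_line_add:
  assumes "bounded_half_line f" "bounded_half_line g" shows "bounded_half_line (\<lambda>t. f t + g t)"
proof -
  obtain K L where "\<forall>t\<ge>0. \<bar>f t\<bar> \<le> K" "\<forall>t\<ge>0. \<bar>g t\<bar> \<le> L"
    using assms by (auto simp: bounded_half_line_def)
  then have "\<bar>f t + g t\<bar> \<le> K + L" if "t \<ge> 0" for t
    using that by (intro order_trans[OF abs_triangle_ineq] add_mono) auto
  then show ?thesis by (rule bounded_half_lineI)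
qed

lemma bounded_half_line_mult:
  assumes "bounded_half_line f" "bounded_half_line g" shows "bounded_half_line (\<lambda>t. f t * g t)"
proof -
  obtain K L where "\<forall>t\<ge>0. \<bar>f t\<bar> \<le> K" "\<forall>t\<ge>0. \<bar>g t\<bar> \<le> L"
    using assms by (auto simp: bounded_half_line_def)
  then have "\<bar>f t * g t\<bar> \<le> \<bar>K\<bar> * \<bar>L\<bar>" if "t \<ge> 0" for t
    unfolding abs_mult using that by (intro mult_mono) force+
  then show ?thesis by (rule bounded_half_lineI)
qed

lemma bounded_half_line_uminus:
  "bounded_half_line f \<Longrightarrow> bounded_half_line (\<lambda>t. - f t)"
  by (simp add: bounded_half_line_def)

lemma bounded_half_line_diff:
  assumes "bounded_half_line f" "bounded_half_line g" shows "bounded_half_line (\<lambda>t. f t - g t)"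
  using bounded_half_line_add[OF assms(1) bounded_half_line_uminus[OF assms(2)]] by simp

lemma bounded_half_line_divide:
  assumes "bounded_half_line f" shows "bounded_half_line (\<lambda>t. f t / c)"
  using bounded_half_line_mult[OF assms bounded_half_line_const[of "inverse c"]]
  by (simp add: divide_inverse)

lemma bounded_half_line_sum:
  assumes "\<And>i. i \<in> I \<Longrightarrow> bounded_half_line (f i)"
  shows "bounded_half_line (\<lambda>t. \<Sum>i\<in>I. f i t)"
  using assms by (induction I rule: infinite_finite_induct) (auto intro: bounded_half_line_add)

lemma bounded_half_line_sin: "bounded_half_line (\<lambda>t. sin (f t))"
  by (rule bounded_half_lineI[of _ 1]) simp

lemma bounded_half_line_cong:
  "(\<And>t. t \<ge> 0 \<Longrightarrow> f t = g t) \<Longrightarrow> bounded_half_line f \<longleftrightarrow> bounded_half_line g"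
  by (simp add: bounded_half_line_def)

lemma bounded_half_line_of_square:
  assumes "\<And>t. t \<ge> 0 \<Longrightarrow> c * (f t)\<^sup>2 \<le> K" "c > 0"
  shows "bounded_half_line f"
proof (rule bounded_half_lineI)
  fix t :: real assume "t \<ge> 0"
  then have "\<bar>f t\<bar>\<^sup>2 \<le> K / c" using assms by (simp add: field_simps)
  then show "\<bar>f t\<bar> \<le> sqrt (K / c)" by (rule real_le_rsqrt)
qed

lemmas bounded_half_line_intros =
  bounded_half_line_const bounded_half_line_add bounded_half_line_diff bounded_half_line_mult
  bounded_half_line_uminus bounded_half_line_divide bounded_half_line_sum bounded_half_line_sin

lemma bounded_lipschitz_divide:
  assumes "bounded_lipschitz f" shows "bounded_lipschitz (\<lambda>t. f t / c)"
  using bounded_lipschitz_mult[OF assms bounded_lipschitz_const[of "inverse c"]]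
  by (simp add: divide_inverse)

lemma bounded_lipschitz_derivative:
  assumes "\<And>t. t \<ge> 0 \<Longrightarrow> (f has_real_derivative f' t) (at t within {0..})"
    and "bounded_half_line f" "bounded_half_line f'"
  shows "bounded_lipschitz f"
proof -
  obtain K L where "\<forall>t\<ge>0. \<bar>f t\<bar> \<le> K" "\<forall>t\<ge>0. \<bar>f' t\<bar> \<le> L"
    using assms(2,3) by (auto simp: bounded_half_line_def)
  then show ?thesis by (intro bounded_lipschitz_of_derivative[OF assms(1)]) auto
qed

lemma tendsto_0_of_square:
  assumes "((\<lambda>t. (f t)\<^sup>2) \<longlongrightarrow> (0::real)) F" shows "(f \<longlongrightarrow> 0) F"
  using tendsto_real_sqrt[OF assms] by (simp add: tendsto_rabs_zero_iff)

lemma tendsto_0_cmult_iff: "c \<noteq> 0 \<Longrightarrow> ((\<lambda>t. c * f t) \<longlongrightarrow> 0) F \<longleftrightarrow> (f \<longlongrightarrow> (0::real)) F"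
  using tendsto_mult_left_iff[of c f 0 F] by simp

lemma bounded_vec_half_line:
  fixes f :: "real \<Rightarrow> real ^ 'm::finite"
  assumes "\<And>i. bounded_half_line (\<lambda>t. f t $ i)"
  shows "bounded (f ` {0..})"
proof -
  have "\<forall>i. \<exists>K. \<forall>t\<ge>0. \<bar>f t $ i\<bar> \<le> K"
    using assms by (simp add: bounded_half_line_def)
  then obtain K where K: "\<And>i t. t \<ge> 0 \<Longrightarrow> \<bar>f t $ i\<bar> \<le> K i" by metis
  have "norm (f t) \<le> (\<Sum>i\<in>UNIV. K i)" if "t \<ge> 0" for t
    using K[OF that] by (intro order_trans[OF norm_le_l1_cart] sum_mono) auto
  then show ?thesis unfolding bounded_iff by auto
qed

subsection \<open>Quadratic forms and graphs\<close>

text \<open>The constant is the minimum of \<open>q\<close> on the compact unit sphere, which a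
  basis vector shows to be nonempty; homogeneity of degree two carries the bound to all
  vectors.\<close>

lemma quadratic_coercive:
  fixes q :: "'a::euclidean_space \<Rightarrow> real"
  assumes cont: "continuous_on UNIV q" and hom: "\<And>a y. q (a *\<^sub>R y) = a\<^sup>2 * q y"
    and pos: "\<And>y. y \<noteq> 0 \<Longrightarrow> q y > 0"
  obtains c where "c > 0" "\<And>y. c * (norm y)\<^sup>2 \<le> q y"
proof -
  have "\<exists>y\<in>sphere (0::'a) 1. \<forall>z\<in>sphere 0 1. q y \<le> q z"
    by (intro continuous_attains_inf continuous_on_subset[OF cont])
      (auto intro: exI[of _ "SOME b. b \<in> Basis"] simp: norm_Basis some_in_eq)
  then obtain y where y: "norm y = 1" "\<And>z. norm z = 1 \<Longrightarrow> q y \<le> q z" by auto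
  have "q y * (norm z)\<^sup>2 \<le> q z" for z
  proof (cases "z = 0")
    case True
    then show ?thesis using hom[of 0 z] by simp
  next
    case False
    have "q y \<le> q (inverse (norm z) *\<^sub>R z)" using False by (intro y) auto
    then have "q y * (norm z)\<^sup>2 \<le> (inverse (norm z))\<^sup>2 * q z * (norm z)\<^sup>2"
      unfolding hom by (rule mult_right_mono) simp
    also have "\<dots> = q z" using False by (simp add: field_simps)
    finally show ?thesis .
  qed
  moreover have "q y > 0" using y(1) by (intro pos) auto
  ultimately show ?thesis using that by blast
qed

text \<open>An equivalence relation that holds along edges holds throughout a connected graph. Exact
  equality at equilibria and asymptotic equality of the communicated variables are both of this
  kind.\<close>

lemma connected_graph_induct:
  assumes "connected_graph A R" "i \<in> A" "j \<in> A"
    and refl: "\<And>i. P i i"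
    and sym: "\<And>i j. P i j \<Longrightarrow> P j i"
    and trans: "\<And>i j k. P i j \<Longrightarrow> P j k \<Longrightarrow> P i k"
    and edge: "\<And>i j. (i, j) \<in> R \<Longrightarrow> i \<in> A \<Longrightarrow> j \<in> A \<Longrightarrow> P i j"
  shows "P i j"
proof -
  have "(i, j) \<in> ((R \<union> R\<inverse>) \<inter> A \<times> A)\<^sup>*"
    using assms(1-3) by (auto simp: connected_graph_def)
  then show ?thesis
  proof (induction rule: rtrancl_induct)
    case base
    show ?case by (rule refl)
  next
    case (step j k)
    then have "P j k" using edge sym by blast
    with step.IH show ?case by (rule trans)
  qed
qed

text \<open>Irreflexivity makes the diagonal degree count exactly the off-diagonal entries
  \<open>- 1\<close>, so the degree times \<open>v $ i\<close> can be distributed over the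
  neighbours.\<close>

lemma laplacian_mult_nth:
  assumes "irrefl R"
  shows "(laplacian R *v v) $ i = (\<Sum>j | (i, j) \<in> R. v $ i - v $ j)"
proof -
  have "(laplacian R *v v) $ i =
      (\<Sum>j\<in>UNIV. (if j = i then real (card {k. (i, k) \<in> R}) * v $ j else 0) +
         (if (i, j) \<in> R then - v $ j else 0))"
    using assms by (auto simp: matrix_vector_mult_def laplacian_def irrefl_def intro!: sum.cong)
  also have "\<dots> = real (card {k. (i, k) \<in> R}) * v $ i + (\<Sum>j | (i, j) \<in> R. - v $ j)"
    by (simp add: sum.distrib sum.If_cases)
  also have "\<dots> = (\<Sum>j | (i, j) \<in> R. v $ i - v $ j)"
    by (simp add: sum_subtractf sum_negf)
  finally show ?thesis .
qed

lemma sum_out_neighbours: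
  fixes f :: "'n::finite \<Rightarrow> 'n \<Rightarrow> real"
  shows "(\<Sum>i\<in>UNIV. \<Sum>j | (i, j) \<in> R. f i j) = (\<Sum>(i, j)\<in>R. f i j)"
proof -
  have "Sigma UNIV (\<lambda>i. {j. (i, j) \<in> R}) = R" by auto
  then show ?thesis by (simp add: sum.Sigma)
qed

lemma sum_in_neighbours:
  fixes f :: "'n::finite \<Rightarrow> 'n \<Rightarrow> real"
  shows "(\<Sum>j\<in>UNIV. \<Sum>i | (i, j) \<in> R. f i j) = (\<Sum>(i, j)\<in>R. f i j)"
proof -
  have "(\<Sum>(i, j)\<in>R. f i j) = (\<Sum>(j, i)\<in>R\<inverse>. f i j)"
    by (rule sum.reindex_bij_witness[of _ "\<lambda>(i, j). (j, i)" "\<lambda>(i, j). (j, i)"]) auto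
  then show ?thesis
    using sum_out_neighbours[of "\<lambda>j i. f i j" "R\<inverse>"] by simp
qed

text \<open>By symmetry of \<open>R\<close> the sum may be taken with every edge reversed; adding
  both versions yields the product of differences. The factor \<open>1 / 2\<close> arises since each
  undirected edge occurs in both orientations.\<close>

lemma laplacian_form:
  fixes v :: "real ^ 'n::finite"
  assumes "sym R" "irrefl R"
  shows "w \<bullet> (laplacian R *v v) = 1 / 2 * (\<Sum>(i, j)\<in>R. (w $ i - w $ j) * (v $ i - v $ j))"
proof -
  have *: "w \<bullet> (laplacian R *v v) = (\<Sum>(i, j)\<in>R. w $ i * (v $ i - v $ j))"
    by (simp add: inner_vec_def laplacian_mult_nth[OF assms(2)] sum_distrib_left
        sum_out_neighbours[of "\<lambda>i j. w $ i * (v $ i - v $ j)"])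
  also have "\<dots> = (\<Sum>(i, j)\<in>R. w $ j * (v $ j - v $ i))"
    using assms(1) by (intro sum.reindex_bij_witness[of _ "\<lambda>(i, j). (j, i)" "\<lambda>(i, j). (j, i)"])
      (auto simp: sym_def)
  finally have "2 * (w \<bullet> (laplacian R *v v)) =
      (\<Sum>(i, j)\<in>R. w $ i * (v $ i - v $ j) + w $ j * (v $ j - v $ i))"
    using * by (simp add: sum.distrib split_def)
  also have "\<dots> = (\<Sum>(i, j)\<in>R. (w $ i - w $ j) * (v $ i - v $ j))"
    by (intro sum.cong) (auto simp: algebra_simps)
  finally show ?thesis by simp
qed

subsection \<open>Power balance and equilibria\<close>

locale hybrid_grid =
  fixes net :: "'n::finite network"
  assumes hybrid: "hybrid_network net"
begin

lemma ac_un_dc: "ac_buses net \<union> dc_buses net = UNIV"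
  and ac_int_dc: "ac_buses net \<inter> dc_buses net = {}"
  and ac_partition: "partition_on (ac_buses net) (ac_subs net)"
  and dc_partition: "partition_on (dc_buses net) (dc_subs net)"
  and lines_split: "lines net = ac_lines net \<union> dc_lines net"
  and ilcs_subset: "ilcs net \<subseteq> ac_buses net \<times> dc_buses net"
  and inj_fst_ilcs: "inj_on fst (ilcs net)"
  and inj_snd_ilcs: "inj_on snd (ilcs net)"
  and connected: "connected_graph UNIV (lines net \<union> ilcs net)"
  and sym_comm: "sym (comm net)"
  and irrefl_comm: "irrefl (comm net)"
  and connected_comm: "connected_graph UNIV (comm net)"
  and gain_pos: "gain net > 0"
  and time_const_diag: "i \<noteq> j \<Longrightarrow> time_const net $ i $ j = 0"
  and time_const_pos: "time_const net $ i $ i > 0"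
  and inertia_pos: "j \<in> gen_buses net \<Longrightarrow> inertia net j > 0"
  and damping_pos: "j \<in> gen_buses net \<Longrightarrow> damping net j > 0"
  and capacitance_pos: "j \<in> dc_buses net \<Longrightarrow> capacitance net j > 0"
  and susceptance_pos: "e \<in> ac_lines net \<Longrightarrow> susceptance net e > 0"
  and conductance_pos: "e \<in> dc_lines net \<Longrightarrow> conductance net e > 0"
  and cost_diag: "i \<noteq> j \<Longrightarrow> cost net $ i $ j = 0"
  and cost_pos_def: "positive_definite (cost net)"
  and ac_subs_nonempty: "ac_subs net \<noteq> {}"
  using hybrid unfolding hybrid_network_def diagonal_matrix_def by auto

lemma connected_dc_sub: "K \<in> dc_subs net \<Longrightarrow> connected_graph K (lines net)"
  using hybrid unfolding hybrid_network_def by auto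

lemma not_ac_iff: "j \<notin> ac_buses net \<longleftrightarrow> j \<in> dc_buses net"
  using ac_un_dc ac_int_dc by auto

lemma dc_sub_of_eq:
  assumes "K \<in> dc_subs net" "j \<in> K" shows "dc_sub_of net j = K"
  unfolding dc_sub_of_def
  using assms dc_partition by (intro the_equality) (auto simp: partition_on_def disjoint_def)

lemma dc_sub_subset: "K \<in> dc_subs net \<Longrightarrow> K \<subseteq> dc_buses net"
  by (auto simp: dc_buses_def)

lemma sum_dc_buses: "(\<Sum>j\<in>dc_buses net. f j) = (\<Sum>K\<in>dc_subs net. \<Sum>j\<in>K. f j)"
  for f :: "'n \<Rightarrow> real"
  using dc_partition unfolding dc_buses_def partition_on_def disjoint_def
  by (intro sum.Union_disjoint[unfolded comp_def]) auto

lemma ac_lineD: "(i, j) \<in> ac_lines net \<Longrightarrow> i \<in> ac_buses net \<and> j \<in> ac_buses net"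
  by (auto simp: ac_lines_def ac_buses_def)

lemma dc_lineD: "(i, j) \<in> dc_lines net \<Longrightarrow> i \<in> dc_buses net \<and> j \<in> dc_buses net"
  by (auto simp: dc_lines_def dc_buses_def)

lemma ac_dc_lines_disjoint: "ac_lines net \<inter> dc_lines net = {}"
  using ac_int_dc by (auto dest: ac_lineD dc_lineD)

lemma x_ac_subset: "x_ac net \<subseteq> ac_buses net"
  and x_dc_subset: "x_dc net \<subseteq> dc_buses net"
  using ilcs_subset by (auto simp: x_ac_def x_dc_def)

lemma x_disjoint: "x_ac net \<inter> x_dc net = {}"
  using x_ac_subset x_dc_subset ac_int_dc by auto

lemma UNIV_split: "UNIV = gen_buses net \<union> x_ac net \<union> dc_buses net"
  "gen_buses net \<inter> x_ac net = {}" "(gen_buses net \<union> x_ac net) \<inter> dc_buses net = {}"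
  using ac_un_dc ac_int_dc x_ac_subset by (auto simp: gen_buses_def)

lemma gen_buses_not_ilc: "j \<in> gen_buses net \<Longrightarrow> j \<notin> x_ac net \<union> x_dc net"
  using x_dc_subset ac_int_dc by (auto simp: gen_buses_def)

lemma sum_UNIV_split:
  "(\<Sum>j\<in>UNIV. f j) = (\<Sum>j\<in>gen_buses net. f j) + (\<Sum>j\<in>x_ac net. f j) + (\<Sum>j\<in>dc_buses net. f j)"
  for f :: "'n \<Rightarrow> real"
  using UNIV_split by (metis finite sum.union_disjoint)

lemma ex_not_x_ac: "\<exists>j. j \<notin> x_ac net"
proof (cases "ilcs net = {}")
  case False
  then show ?thesis using x_disjoint by (force simp: x_dc_def)
qed (simp add: x_ac_def)

text \<open>Without converters no edge joins an AC bus to a DC bus, so connectedness leaves only one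
  side, and the existing AC subsystem decides which. This settles the case in which no converter bus
  is available for comparison: every bus is then damped.\<close>

lemma no_ilc_imp_ac:
  assumes "x_ac net = {}" shows "j \<in> ac_buses net"
proof -
  obtain S where S: "S \<in> ac_subs net" using ac_subs_nonempty by auto
  then have "S \<noteq> {}" using ac_partition unfolding partition_on_def by metis
  then obtain i where i: "i \<in> ac_buses net" using S by (auto simp: ac_buses_def)
  have "ilcs net = {}" using assms by (auto simp: x_ac_def)
  have "i \<in> ac_buses net \<longleftrightarrow> j \<in> ac_buses net"
  proof (rule connected_graph_induct[OF connected,
        where P="\<lambda>i j. i \<in> ac_buses net \<longleftrightarrow> j \<in> ac_buses net"])
    fix i j assume "(i, j) \<in> lines net \<union> ilcs net"
    then have "(i, j) \<in> ac_lines net \<or> (i, j) \<in> dc_lines net"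
      using \<open>ilcs net = {}\<close> lines_split by simp
    then show "i \<in> ac_buses net \<longleftrightarrow> j \<in> ac_buses net"
      using ac_lineD dc_lineD not_ac_iff by blast
  qed auto
  with i show ?thesis by simp
qed

definition cost_recip :: "'n \<Rightarrow> real" where
  "cost_recip j = (if j \<in> x_ac net then 0 else inverse (cost net $ j $ j))"

lemma cost_entry_pos: "cost net $ j $ j > 0"
proof -
  have "axis j 1 \<bullet> (cost net *v axis j 1) > (0 :: real)"
    using cost_pos_def unfolding positive_definite_def by (auto simp: axis_eq_0_iff)
  then show ?thesis by (simp add: inner_axis' matrix_vector_mul_component inner_axis)
qed

lemma cost_recip_pos: "j \<notin> x_ac net \<Longrightarrow> cost_recip j > 0"
  and cost_recip_nonneg: "cost_recip j \<ge> 0"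
  and cost_recip_x_ac: "j \<in> x_ac net \<Longrightarrow> cost_recip j = 0"
  using cost_entry_pos[of j] by (auto simp: cost_recip_def less_imp_le)

lemma cost_inv_mult_nth: "(cost_inv net *v u) $ j = cost_recip j * u $ j"
proof -
  have "(cost_inv net *v u) $ j = (\<Sum>i\<in>UNIV. if i = j then cost_recip j * u $ j else 0)"
    unfolding matrix_vector_mult_def cost_inv_def cost_recip_def vec_lambda_beta
    by (intro sum.cong) auto
  then show ?thesis by simp
qed

lemma diag_mult_nth:
  fixes A :: "real ^ 'n ^ 'n"
  assumes "\<And>i j. i \<noteq> j \<Longrightarrow> A $ i $ j = 0" shows "(A *v u) $ j = A $ j $ j * u $ j"
proof -
  have "(A *v u) $ j = (\<Sum>i\<in>UNIV. if i = j then A $ j $ j * u $ j else 0)"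
    unfolding matrix_vector_mult_def vec_lambda_beta using assms by (intro sum.cong) auto
  then show ?thesis by simp
qed

lemma sync_rate_nth:
  "sync_rate net v $ j =
     - (\<Sum>k | (j, k) \<in> comm net. sync v $ j - sync v $ k) - cost_recip j * virtual_freq net v $ j"
  by (simp add: sync_rate_def laplacian_mult_nth[OF irrefl_comm] cost_inv_mult_nth)

lemma gen_nth: "algebraic_relations net v \<Longrightarrow> gen v $ j = cost_recip j * sync v $ j"
  by (simp add: algebraic_relations_def cost_inv_mult_nth)

lemma virtual_freq_ac: "j \<in> ac_buses net \<Longrightarrow> virtual_freq net v $ j = freq v j"
  by (simp add: virtual_freq_def)

lemma virtual_freq_dc:
  "K \<in> dc_subs net \<Longrightarrow> j \<in> K \<Longrightarrow> virtual_freq net v $ j = gain net * avg_volt net v K"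
  using dc_sub_subset[of K] ac_int_dc by (auto simp: virtual_freq_def dc_sub_of_eq)

lemma virtual_freq_dc_line:
  "(i, j) \<in> dc_lines net \<Longrightarrow> virtual_freq net v $ i = virtual_freq net v $ j"
  by (auto simp: dc_lines_def virtual_freq_dc)

text \<open>The converter control law read as continuity: the virtual frequency extends the
  frequency to DC buses exactly so that the law equates the two ends of a converter.\<close>

lemma virtual_freq_ilc:
  assumes "algebraic_relations net v" "(i, k) \<in> ilcs net"
  shows "virtual_freq net v $ i = virtual_freq net v $ k"
proof -
  obtain K where K: "K \<in> dc_subs net" "k \<in> K"
    using ilcs_subset assms(2) by (auto simp: dc_buses_def)
  then have "freq v i = gain net * avg_volt net v K"
    using assms unfolding algebraic_relations_def by blast
  moreover have "i \<in> ac_buses net" using ilcs_subset assms(2) by auto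
  ultimately show ?thesis using K by (simp add: virtual_freq_ac virtual_freq_dc)
qed

lemma conv_ilc: "algebraic_relations net v \<Longrightarrow> (i, k) \<in> ilcs net \<Longrightarrow> conv v k = - conv v i"
  and conv_no_ilc: "algebraic_relations net v \<Longrightarrow> j \<notin> x_ac net \<union> x_dc net \<Longrightarrow> conv v j = 0"
  and conv_x_ac: "algebraic_relations net v \<Longrightarrow> j \<in> x_ac net \<Longrightarrow> conv v j = net_power net v j"
  by (auto simp: algebraic_relations_def)

text \<open>Injectivity of both projections allows the sum to be taken over converters instead of
  buses; then the two ends of each lossless converter cancel under equal weights.\<close>

lemma sum_conv_eq_0:
  assumes "algebraic_relations net v" and w: "\<And>i k. (i, k) \<in> ilcs net \<Longrightarrow> w i = w k"
  shows "(\<Sum>j\<in>UNIV. w j * conv v j) = 0"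
proof -
  have "(\<Sum>j\<in>UNIV. w j * conv v j) = (\<Sum>j\<in>x_ac net \<union> x_dc net. w j * conv v j)"
    using assms(1) unfolding algebraic_relations_def
    by (intro sum.mono_neutral_right) auto
  also have "\<dots> = (\<Sum>j\<in>x_ac net. w j * conv v j) + (\<Sum>j\<in>x_dc net. w j * conv v j)"
    using x_disjoint by (intro sum.union_disjoint) auto
  also have "\<dots> = (\<Sum>e\<in>ilcs net. w (fst e) * conv v (fst e) + w (snd e) * conv v (snd e))"
    by (simp add: x_ac_def x_dc_def sum.reindex inj_fst_ilcs inj_snd_ilcs sum.distrib)
  also have "\<dots> = 0"
    using assms unfolding algebraic_relations_def by (intro sum.neutral) auto
  finally show ?thesis .
qed

text \<open>Discrete integration by parts: the flow of a line enters with the weight of its head and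
  leaves with the weight of its tail.\<close>

lemma sum_net_power:
  "(\<Sum>j\<in>UNIV. w j * net_power net v j) = (\<Sum>j\<in>UNIV. w j * (gen v $ j - load net $ j)) +
     (\<Sum>(i, j)\<in>lines net. line_flow net v (i, j) * (w j - w i))"
proof -
  have "(\<Sum>j\<in>UNIV. w j * net_power net v j) = (\<Sum>j\<in>UNIV. w j * (gen v $ j - load net $ j)) +
     (\<Sum>j\<in>UNIV. \<Sum>i | (i, j) \<in> lines net. w j * line_flow net v (i, j)) -
     (\<Sum>j\<in>UNIV. \<Sum>k | (j, k) \<in> lines net. w j * line_flow net v (j, k))"
    unfolding net_power_def
    by (simp add: distrib_left right_diff_distrib sum.distrib sum_subtractf sum_distrib_left)
  also have "(\<Sum>j\<in>UNIV. \<Sum>i | (i, j) \<in> lines net. w j * line_flow net v (i, j)) =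
      (\<Sum>(i, j)\<in>lines net. w j * line_flow net v (i, j))"
    by (rule sum_in_neighbours)
  also have "(\<Sum>j\<in>UNIV. \<Sum>k | (j, k) \<in> lines net. w j * line_flow net v (j, k)) =
      (\<Sum>(i, j)\<in>lines net. w i * line_flow net v (i, j))"
    by (rule sum_out_neighbours)
  finally show ?thesis
    by (simp add: split_def right_diff_distrib sum_subtractf algebra_simps)
qed

text \<open>Two weights are of interest: the constant 1 gives the total power balance at an
  equilibrium, and the virtual frequency gives the derivative of the Lyapunov function.\<close>

lemma sum_power_balance:
  assumes "algebraic_relations net v" and "\<And>i k. (i, k) \<in> ilcs net \<Longrightarrow> w i = w k"
    and "\<And>i k. (i, k) \<in> dc_lines net \<Longrightarrow> w i = w k"
  shows "(\<Sum>j\<in>UNIV. w j * (net_power net v j - conv v j)) =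
     (\<Sum>j\<in>UNIV. w j * (gen v $ j - load net $ j)) +
     (\<Sum>(i, j)\<in>ac_lines net. susceptance net (i, j) * sin (angle v (i, j)) * (w j - w i))"
proof -
  have "(\<Sum>(i, j)\<in>lines net. line_flow net v (i, j) * (w j - w i)) =
      (\<Sum>(i, j)\<in>ac_lines net. line_flow net v (i, j) * (w j - w i))"
    unfolding lines_split using assms(3) by (intro sum.mono_neutral_right) auto
  also have "\<dots> = (\<Sum>(i, j)\<in>ac_lines net. susceptance net (i, j) * sin (angle v (i, j)) * (w j - w i))"
    by (intro sum.cong) (auto simp: line_flow_def)
  finally show ?thesis
    using sum_conv_eq_0[OF assms(1,2)] sum_net_power[of w v]
    by (simp add: right_diff_distrib sum_subtractf)
qed

section \<open>Synchrony and optimality at an equilibrium\<close>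

lemma equilibrium_algebraic: "equilibrium net v \<Longrightarrow> algebraic_relations net v"
  by (simp add: equilibrium_def)

lemma equilibrium_virtual_freq:
  assumes "equilibrium net v" shows "virtual_freq net v $ j = 0"
proof -
  have const: "virtual_freq net v $ i = virtual_freq net v $ j" for i
  proof (rule connected_graph_induct[OF connected, where P="\<lambda>i j. virtual_freq net v $ i = virtual_freq net v $ j"])
    fix i j assume "(i, j) \<in> lines net \<union> ilcs net"
    then consider "(i, j) \<in> ac_lines net" | "(i, j) \<in> dc_lines net" | "(i, j) \<in> ilcs net"
      using lines_split by auto
    then show "virtual_freq net v $ i = virtual_freq net v $ j"
    proof cases
      case 1
      then have "freq v i = freq v j" using assms unfolding equilibrium_def by auto
      then show ?thesis using ac_lineD[OF 1] by (simp add: virtual_freq_ac)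
    qed (use assms in \<open>auto intro: virtual_freq_dc_line virtual_freq_ilc simp: equilibrium_def\<close>)
  qed auto
  \<comment> \<open>The all-ones vector annihilates the symmetric Laplacian, so summing the
    synchronization equation over all buses leaves only the virtual frequencies weighted by
    reciprocal costs.\<close>
  have "1 \<bullet> (laplacian (comm net) *v sync v) = 0"
    by (simp add: laplacian_form[OF sym_comm irrefl_comm])
  moreover have "laplacian (comm net) *v sync v = - (cost_inv net *v virtual_freq net v)"
    using assms by (simp add: equilibrium_def sync_rate_def algebra_simps eq_neg_iff_add_eq_0)
  ultimately have "(\<Sum>i\<in>UNIV. cost_recip i * virtual_freq net v $ i) = 0"
    by (simp add: inner_vec_def cost_inv_mult_nth sum_negf)
  moreover have "(\<Sum>i\<in>UNIV. cost_recip i) * virtual_freq net v $ j =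
      (\<Sum>i\<in>UNIV. cost_recip i * virtual_freq net v $ i)"
    unfolding sum_distrib_right by (intro sum.cong arg_cong2[where f="(*)"] refl const[symmetric])
  ultimately have "(\<Sum>i\<in>UNIV. cost_recip i) * virtual_freq net v $ j = 0"
    by simp
  moreover obtain k where "k \<notin> x_ac net" using ex_not_x_ac by auto
  then have "(\<Sum>i\<in>UNIV. cost_recip i) > 0"
    using cost_recip_pos cost_recip_nonneg by (intro sum_pos2[of _ k]) auto
  ultimately show ?thesis by simp
qed

lemma equilibrium_freq: "equilibrium net v \<Longrightarrow> j \<in> ac_buses net \<Longrightarrow> freq v j = 0"
  using equilibrium_virtual_freq[of v j] by (simp add: virtual_freq_ac)

lemma equilibrium_avg_volt:
  assumes "equilibrium net v" "K \<in> dc_subs net" shows "avg_volt net v K = 0"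
proof -
  obtain j where "j \<in> K" using assms(2) dc_partition by (fastforce simp: partition_on_def)
  then show ?thesis
    using equilibrium_virtual_freq[OF assms(1), of j] virtual_freq_dc[OF assms(2), of j v] gain_pos
    by simp
qed

lemma equilibrium_sync:
  assumes "equilibrium net v" shows "sync v $ i = sync v $ j"
proof (rule connected_graph_induct[OF connected_comm, where P="\<lambda>i j. sync v $ i = sync v $ j"])
  have "virtual_freq net v = 0" using equilibrium_virtual_freq[OF assms] by (simp add: vec_eq_iff)
  then have "laplacian (comm net) *v sync v = 0"
    using assms by (simp add: equilibrium_def sync_rate_def)
  then have "(\<Sum>(i, j)\<in>comm net. (sync v $ i - sync v $ j) * (sync v $ i - sync v $ j)) = 0"
    using laplacian_form[OF sym_comm irrefl_comm, of "sync v" "sync v"] by simp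
  then have "\<forall>e\<in>comm net. (sync v $ fst e - sync v $ snd e) * (sync v $ fst e - sync v $ snd e) = 0"
    by (subst (asm) sum_nonneg_eq_0_iff) (auto simp: split_def)
  then show "sync v $ i = sync v $ j" if "(i, j) \<in> comm net" for i j
    using that by force
qed auto

lemma equilibrium_power_balance:
  assumes "equilibrium net v" shows "net_power net v j = conv v j"
proof -
  consider "j \<in> gen_buses net" | "j \<in> x_ac net" | "j \<in> dc_buses net" using UNIV_split(1) by blast
  then show ?thesis
  proof cases
    case 1
    then have "freq v j = 0" "conv v j = 0"
      using equilibrium_freq[OF assms] gen_buses_not_ilc[OF 1] equilibrium_algebraic[OF assms]
      by (auto simp: gen_buses_def algebraic_relations_def)
    then show ?thesis using 1 assms unfolding equilibrium_def by auto
  qed (use assms in \<open>auto simp: equilibrium_def algebraic_relations_def\<close>)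
qed

text \<open>
  At an equilibrium all entries of \<open>sync v\<close> equal one number, which is the common marginal cost,
  so the first-order term of the cost difference vanishes on the constraint set.
\<close>

lemma equilibrium_optimal:
  assumes "equilibrium net v"
  shows "optimal_power_sharing net (freq v) (gen v)"
proof -
  note alg = equilibrium_algebraic[OF assms]
  have freq0: "(\<Sum>j\<in>gen_buses net. damping net j * freq v j) = 0"
    using equilibrium_freq[OF assms] by (intro sum.neutral) (auto simp: gen_buses_def)
  have "(\<Sum>j\<in>UNIV. gen v $ j - load net $ j) = 0"
    using sum_power_balance[OF alg, of "\<lambda>_. 1"] equilibrium_power_balance[OF assms] by simp
  then have feasible: "feasible_generation net (freq v) (gen v)"
    using alg unfolding feasible_generation_def freq0
    by (auto simp: algebraic_relations_def inner_vec_def sum_subtractf)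
  obtain l where l: "\<And>j. sync v $ j = l" using equilibrium_sync[OF assms] by metis
  have "1 / 2 * (gen v \<bullet> (cost net *v gen v)) \<le> 1 / 2 * (q \<bullet> (cost net *v q))"
    if q: "feasible_generation net (freq v) q" for q
  proof -
    let ?c = "\<lambda>j. cost net $ j $ j" and ?p = "\<lambda>j. gen v $ j"
    have *: "u \<bullet> (cost net *v u) = (\<Sum>j\<in>UNIV. ?c j * (u $ j)\<^sup>2)" for u
      by (simp add: inner_vec_def diag_mult_nth[of "cost net", OF cost_diag] power2_eq_square algebra_simps)
    have "(\<Sum>j\<in>UNIV. q $ j - ?p j) = 0"
      using q feasible by (simp add: feasible_generation_def inner_vec_def sum_subtractf)
    then have "0 = (\<Sum>j\<in>UNIV. l * (q $ j - ?p j))" by (simp add: sum_distrib_left[symmetric])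
    also have "\<dots> = (\<Sum>j\<in>UNIV. ?c j * ?p j * (q $ j - ?p j))"
    proof (intro sum.cong refl)
      fix j
      \<comment> \<open>At AC buses with a converter both generations vanish; elsewhere
        \<open>?p j\<close> is \<open>l\<close> divided by \<open>?c j\<close>, so the marginal cost
        \<open>?c j * ?p j\<close> is \<open>l\<close>.\<close>
      show "l * (q $ j - ?p j) = ?c j * ?p j * (q $ j - ?p j)"
      proof (cases "j \<in> x_ac net")
        case True
        then show ?thesis using q feasible by (simp add: feasible_generation_def)
      next
        case False
        then show ?thesis
          using cost_entry_pos[of j] by (simp add: gen_nth[OF alg] l cost_recip_def)
      qed
    qed
    finally have lin: "(\<Sum>j\<in>UNIV. ?c j * ?p j * (q $ j - ?p j)) = 0" ..
    \<comment> \<open>Exact second-order expansion of the separable cost around \<open>?p\<close>;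
      the quadratic remainder is nonnegative.\<close>
    have "(\<Sum>j\<in>UNIV. ?c j * (q $ j)\<^sup>2) = (\<Sum>j\<in>UNIV. ?c j * (?p j)\<^sup>2 +
        2 * (?c j * ?p j * (q $ j - ?p j)) + ?c j * (q $ j - ?p j)\<^sup>2)"
      by (intro sum.cong) (auto simp: power2_eq_square algebra_simps)
    also have "\<dots> = (\<Sum>j\<in>UNIV. ?c j * (?p j)\<^sup>2) + (\<Sum>j\<in>UNIV. ?c j * (q $ j - ?p j)\<^sup>2)"
      using lin by (simp add: sum.distrib sum_distrib_left[symmetric])
    also have "\<dots> \<ge> (\<Sum>j\<in>UNIV. ?c j * (?p j)\<^sup>2)"
      using cost_entry_pos by (simp add: sum_nonneg less_imp_le)
    finally show ?thesis by (simp add: *)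
  qed
  with feasible show ?thesis
    unfolding optimal_power_sharing_def is_arg_min_def by (meson not_less)
qed

section \<open>Net power on the two sides of the network\<close>

lemma dc_net_power:
  assumes "j \<in> dc_buses net"
  shows "net_power net v j = gen v $ j - load net $ j +
    ((\<Sum>i | (i, j) \<in> dc_lines net. conductance net (i, j) * (volt v i - volt v j)) -
     (\<Sum>k | (j, k) \<in> dc_lines net. conductance net (j, k) * (volt v j - volt v k)))"
proof -
  have "{i. (i, j) \<in> lines net} = {i. (i, j) \<in> dc_lines net}"
    "{k. (j, k) \<in> lines net} = {k. (j, k) \<in> dc_lines net}"
    using assms lines_split ac_int_dc by (auto dest: ac_lineD)
  moreover have "line_flow net v e = conductance net e * (volt v (fst e) - volt v (snd e))"
    if "e \<in> dc_lines net" for e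
    using that ac_dc_lines_disjoint by (auto simp: line_flow_def)
  ultimately show ?thesis by (simp add: net_power_def)
qed

lemma ac_net_power:
  assumes "j \<in> ac_buses net"
  shows "net_power net v j = gen v $ j - load net $ j +
    (\<Sum>i | (i, j) \<in> ac_lines net. susceptance net (i, j) * sin (angle v (i, j))) -
     (\<Sum>k | (j, k) \<in> ac_lines net. susceptance net (j, k) * sin (angle v (j, k)))"
proof -
  have "{i. (i, j) \<in> lines net} = {i. (i, j) \<in> ac_lines net}"
    "{k. (j, k) \<in> lines net} = {k. (j, k) \<in> ac_lines net}"
    using assms lines_split ac_int_dc by (auto dest: dc_lineD)
  then show ?thesis by (simp add: net_power_def line_flow_def)
qed

subsection \<open>Dissipation in the DC subsystems\<close>

text \<open>Minus the conductance-weighted Laplacian of the DC lines applied to \<open>y\<close>.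
  Its linearity in \<open>y\<close> is what later makes differences of time-shifted voltages
  tractable.\<close>

definition dc_inflow :: "('n \<Rightarrow> real) \<Rightarrow> 'n \<Rightarrow> real" where
  "dc_inflow y j = (\<Sum>i | (i, j) \<in> dc_lines net. conductance net (i, j) * (y i - y j)) -
     (\<Sum>k | (j, k) \<in> dc_lines net. conductance net (j, k) * (y j - y k))"

lemma sum_dc_inflow:
  "(\<Sum>j\<in>dc_buses net. w j * dc_inflow y j) =
    (\<Sum>(i, j)\<in>dc_lines net. conductance net (i, j) * (y i - y j) * (w j - w i))"
proof -
  have "dc_inflow y j = 0" if "j \<notin> dc_buses net" for j
  proof -
    have "{i. (i, j) \<in> dc_lines net} = {}" "{k. (j, k) \<in> dc_lines net} = {}"
      using that by (auto dest: dc_lineD)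
    then show ?thesis by (simp add: dc_inflow_def)
  qed
  then have "(\<Sum>j\<in>dc_buses net. w j * dc_inflow y j) = (\<Sum>j\<in>UNIV. w j * dc_inflow y j)"
    by (intro sum.mono_neutral_left) auto
  also have "\<dots> =
     (\<Sum>j\<in>UNIV. \<Sum>i | (i, j) \<in> dc_lines net. w j * (conductance net (i, j) * (y i - y j))) -
     (\<Sum>j\<in>UNIV. \<Sum>k | (j, k) \<in> dc_lines net. w j * (conductance net (j, k) * (y j - y k)))"
    unfolding dc_inflow_def by (simp add: right_diff_distrib[of "w _" "sum _ _"] sum_subtractf sum_distrib_left)
  also have "(\<Sum>j\<in>UNIV. \<Sum>i | (i, j) \<in> dc_lines net. w j * (conductance net (i, j) * (y i - y j))) =
      (\<Sum>(i, j)\<in>dc_lines net. w j * (conductance net (i, j) * (y i - y j)))"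
    by (rule sum_in_neighbours)
  also have "(\<Sum>j\<in>UNIV. \<Sum>k | (j, k) \<in> dc_lines net. w j * (conductance net (j, k) * (y j - y k))) =
      (\<Sum>(i, j)\<in>dc_lines net. w i * (conductance net (i, j) * (y i - y j)))"
    by (rule sum_out_neighbours)
  finally show ?thesis
    unfolding sum_subtractf[symmetric] by (simp add: split_def algebra_simps)
qed

text \<open>The indicator function of \<open>K\<close> is constant along every DC line, so as a
  weight it annihilates all line flows: lines only redistribute power within a subsystem.\<close>

lemma sum_dc_inflow_sub:
  assumes "K \<in> dc_subs net" shows "(\<Sum>j\<in>K. dc_inflow y j) = 0"
proof -
  define w where "w j = (if j \<in> K then 1 else 0 :: real)" for j
  have "w i = w j" if "(i, j) \<in> dc_lines net" for i j
  proof -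
    obtain S where S: "S \<in> dc_subs net" "i \<in> S" "j \<in> S" using \<open>(i, j) \<in> dc_lines net\<close>
      by (auto simp: dc_lines_def)
    then have "i \<in> K \<longleftrightarrow> S = K" "j \<in> K \<longleftrightarrow> S = K"
      using dc_sub_of_eq assms by blast+
    then show ?thesis by (simp add: w_def)
  qed
  then have "(\<Sum>j\<in>dc_buses net. w j * dc_inflow y j) = 0"
    unfolding sum_dc_inflow by (intro sum.neutral) auto
  moreover have "(\<Sum>j\<in>dc_buses net. w j * dc_inflow y j) = (\<Sum>j\<in>K. dc_inflow y j)"
    unfolding w_def using dc_sub_subset[OF assms]
    by (intro sum.mono_neutral_cong_right) auto
  ultimately show ?thesis by simp
qed

text \<open>Vanishing line terms make \<open>y\<close> constant on each subsystem by connectedness,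
  and a vanishing average with positive capacitances forces that constant to be zero. Compactness
  then turns definiteness into a uniform constant.\<close>

lemma dc_form_coercive:
  obtains c where "c > 0" "\<And>y. c * (\<Sum>j\<in>dc_buses net. (y j)\<^sup>2) \<le>
    (\<Sum>(i, j)\<in>dc_lines net. conductance net (i, j) * (y i - y j)\<^sup>2) +
    (\<Sum>K\<in>dc_subs net. (\<Sum>j\<in>K. capacitance net j * y j)\<^sup>2)"
proof -
  define g where "g y = (\<Sum>e\<in>dc_lines net. conductance net e * (y (fst e) - y (snd e))\<^sup>2)" for y
  define s where "s y = (\<Sum>K\<in>dc_subs net. (\<Sum>j\<in>K. capacitance net j * y j)\<^sup>2)" for y
  \<comment> \<open>The squares of the AC coordinates make the form definite on the whole of
    \<open>real ^ 'n\<close>; they drop out for the vector \<open>z\<close> below, which is zero on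
    AC buses.\<close>
  define q where "q y = g (($) y) + s (($) y) + (\<Sum>j\<in>ac_buses net. (y $ j)\<^sup>2)" for y :: "real ^ 'n"
  have g_nonneg: "g y \<ge> 0" and s_nonneg: "s y \<ge> 0" for y
    unfolding g_def s_def using conductance_pos by (auto intro!: sum_nonneg simp: less_imp_le)
  have "continuous_on UNIV q"
    unfolding q_def g_def s_def by (intro continuous_intros)
  moreover have "q (a *\<^sub>R y) = a\<^sup>2 * q y" for a y
  proof -
    have "g (($) (a *\<^sub>R y)) = a\<^sup>2 * g (($) y)"
      unfolding g_def sum_distrib_left
      by (intro sum.cong refl) (simp add: power2_eq_square algebra_simps)
    moreover have "(\<Sum>j\<in>K. capacitance net j * (a *\<^sub>R y) $ j) = a * (\<Sum>j\<in>K. capacitance net j * y $ j)" for K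
      unfolding sum_distrib_left by (intro sum.cong refl) simp
    then have "s (($) (a *\<^sub>R y)) = a\<^sup>2 * s (($) y)"
      by (simp only: s_def power_mult_distrib sum_distrib_left[of "a\<^sup>2"])
    ultimately show ?thesis
      by (simp add: q_def distrib_left power_mult_distrib sum_distrib_left)
  qed
  moreover have "q y > 0" if "y \<noteq> 0" for y
  proof (rule ccontr)
    assume "\<not> q y > 0"
    moreover have "(\<Sum>j\<in>ac_buses net. (y $ j)\<^sup>2) \<ge> 0" by (intro sum_nonneg) auto
    ultimately have "g (($) y) = 0" "s (($) y) = 0" and "(\<Sum>j\<in>ac_buses net. (y $ j)\<^sup>2) = 0"
      using g_nonneg[of "($) y"] s_nonneg[of "($) y"] by (simp_all add: q_def)
    then have g0: "\<And>e. e \<in> dc_lines net \<Longrightarrow> y $ fst e = y $ snd e"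
      and s0: "\<And>K. K \<in> dc_subs net \<Longrightarrow> (\<Sum>j\<in>K. capacitance net j * y $ j) = 0"
      and a0: "\<And>j. j \<in> ac_buses net \<Longrightarrow> y $ j = 0"
      unfolding g_def s_def using conductance_pos
      by (subst (asm) sum_nonneg_eq_0_iff; force simp: less_imp_le)+
    have "y $ j = 0" for j
    proof (cases "j \<in> ac_buses net")
      case False
      then obtain K where K: "K \<in> dc_subs net" "j \<in> K"
        using not_ac_iff by (auto simp: dc_buses_def)
      have const: "y $ i = y $ j" if "i \<in> K" for i
      proof (rule connected_graph_induct[OF connected_dc_sub[OF K(1)] that K(2), where P="\<lambda>i j. y $ i = y $ j"])
        fix i k assume "(i, k) \<in> lines net" "i \<in> K" "k \<in> K"
        then have "(i, k) \<in> dc_lines net" using K by (auto simp: dc_lines_def)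
        then show "y $ i = y $ k" using g0 by force
      qed auto
      have "(\<Sum>i\<in>K. capacitance net i) * y $ j = (\<Sum>i\<in>K. capacitance net i * y $ i)"
        unfolding sum_distrib_right using const by (intro sum.cong) auto
      also have "\<dots> = 0" using s0[OF K(1)] .
      finally have "(\<Sum>i\<in>K. capacitance net i) * y $ j = 0" .
      moreover have "(\<Sum>i\<in>K. capacitance net i) > 0"
        using K dc_sub_subset[OF K(1)] capacitance_pos by (intro sum_pos) auto
      ultimately show ?thesis by simp
    qed (rule a0)
    with \<open>y \<noteq> 0\<close> show False by (simp add: vec_eq_iff)
  qed
  ultimately obtain c where c: "c > 0" "\<And>y. c * (norm y)\<^sup>2 \<le> q y"
    using quadratic_coercive[of q] by blast
  have "c * (\<Sum>j\<in>dc_buses net. (y j)\<^sup>2) \<le> g y + s y" for y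
  proof -
    define z :: "real ^ 'n" where "z = (\<chi> j. if j \<in> dc_buses net then y j else 0)"
    have "(norm z)\<^sup>2 = (\<Sum>j\<in>dc_buses net. (y j)\<^sup>2)"
      unfolding power2_norm_eq_inner inner_vec_def z_def
      by (intro sum.mono_neutral_cong_right) (auto simp: power2_eq_square)
    moreover have "q z = g y + s y"
    proof -
      have "(\<Sum>j\<in>ac_buses net. (z $ j)\<^sup>2) = 0"
        using ac_int_dc by (intro sum.neutral) (auto simp: z_def)
      moreover have "g (($) z) = g y"
        unfolding g_def z_def by (intro sum.cong) (auto dest: dc_lineD)
      moreover have "s (($) z) = s y"
        unfolding s_def z_def using dc_sub_subset
        by (intro sum.cong arg_cong[where f="\<lambda>x. x\<^sup>2"]) auto
      ultimately show ?thesis by (simp add: q_def)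
    qed
    ultimately show ?thesis using c(2)[of z] by simp
  qed
  then show ?thesis
    using that[OF c(1)] by (simp add: g_def s_def split_def)
qed

section \<open>Decay of the DC energy\<close>

definition dc_energy :: "('n \<Rightarrow> real) \<Rightarrow> real" where
  "dc_energy y = (\<Sum>j\<in>dc_buses net. capacitance net j / 2 * (y j)\<^sup>2)"

lemma dc_energy_nonneg: "dc_energy y \<ge> 0"
  unfolding dc_energy_def using capacitance_pos by (intro sum_nonneg) (simp add: less_imp_le)

lemma dc_energy_ge: "j \<in> dc_buses net \<Longrightarrow> capacitance net j / 2 * (y j)\<^sup>2 \<le> dc_energy y"
  unfolding dc_energy_def using capacitance_pos by (intro member_le_sum) (auto simp: less_imp_le)

text \<open>Line losses control voltages only up to a constant on each subsystem, so the averages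
  appear on the right as a further disturbance next to \<open>u\<close>.\<close>

lemma dc_dissipation:
  obtains a b where "a > 0" "b > 0"
    "\<And>y u. (\<Sum>j\<in>dc_buses net. y j * (dc_inflow y j + u j)) \<le> - a * dc_energy y +
       ((\<Sum>K\<in>dc_subs net. (\<Sum>j\<in>K. capacitance net j * y j)\<^sup>2) + b * (\<Sum>j\<in>dc_buses net. (u j)\<^sup>2))"
proof -
  obtain c where c: "c > 0" and coercive: "\<And>y. c * (\<Sum>j\<in>dc_buses net. (y j)\<^sup>2) \<le>
    (\<Sum>(i, j)\<in>dc_lines net. conductance net (i, j) * (y i - y j)\<^sup>2) +
    (\<Sum>K\<in>dc_subs net. (\<Sum>j\<in>K. capacitance net j * y j)\<^sup>2)"
    by (rule dc_form_coercive) blast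
  \<comment> \<open>\<open>C\<close> dominates every capacitance and is positive even if there is no
    DC bus. The choice \<open>a = c / C\<close> then bounds \<open>a * dc_energy y\<close> by half
    of the coercivity term.\<close>
  define C where "C = (\<Sum>j\<in>dc_buses net. capacitance net j) + 1"
  have C: "C > 0" "\<And>j. j \<in> dc_buses net \<Longrightarrow> capacitance net j \<le> C"
  proof -
    have nonneg: "\<And>j. j \<in> dc_buses net \<Longrightarrow> capacitance net j \<ge> 0"
      using capacitance_pos by (simp add: less_imp_le)
    then have "(\<Sum>j\<in>dc_buses net. capacitance net j) \<ge> 0" by (rule sum_nonneg)
    then show "C > 0" by (simp add: C_def)
    show "capacitance net j \<le> C" if "j \<in> dc_buses net" for j
      using member_le_sum[of j "dc_buses net" "capacitance net"] nonneg that by (simp add: C_def)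
  qed
  define a where "a = c / C"
  \<comment> \<open>The constant of Young's inequality when \<open>y j * u j\<close> is absorbed by
    the remaining half of the coercivity term, that is, by
    \<open>c / 2 * (y j)\<^sup>2\<close>.\<close>
  define b where "b = 1 / (2 * c)"
  have "(\<Sum>j\<in>dc_buses net. y j * (dc_inflow y j + u j)) \<le> - a * dc_energy y +
       ((\<Sum>K\<in>dc_subs net. (\<Sum>j\<in>K. capacitance net j * y j)\<^sup>2) + b * (\<Sum>j\<in>dc_buses net. (u j)\<^sup>2))"
    for y u
  proof -
    have "a * dc_energy y = (\<Sum>j\<in>dc_buses net. a * (capacitance net j / 2 * (y j)\<^sup>2))"
      by (simp add: dc_energy_def sum_distrib_left)
    also have "\<dots> \<le> (\<Sum>j\<in>dc_buses net. c / 2 * (y j)\<^sup>2)"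
    proof (intro sum_mono)
      fix j assume "j \<in> dc_buses net"
      then have "a * capacitance net j \<le> c"
        using C(2)[of j] C(1) c by (simp add: a_def field_simps)
      then have "(a * capacitance net j) * ((y j)\<^sup>2 / 2) \<le> c * ((y j)\<^sup>2 / 2)"
        by (intro mult_right_mono) auto
      then show "a * (capacitance net j / 2 * (y j)\<^sup>2) \<le> c / 2 * (y j)\<^sup>2" by simp
    qed
    finally have 1: "a * dc_energy y \<le> c / 2 * (\<Sum>j\<in>dc_buses net. (y j)\<^sup>2)"
      by (simp add: sum_distrib_left)
    have "y j * u j \<le> c / 2 * (y j)\<^sup>2 + b * (u j)\<^sup>2" for j
    proof -
      have "0 \<le> (c * y j - u j)\<^sup>2 / (2 * c)" using c by simp
      also have "\<dots> = c / 2 * (y j)\<^sup>2 + b * (u j)\<^sup>2 - y j * u j"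
        using c by (simp add: b_def power2_eq_square field_simps)
      finally show ?thesis by simp
    qed
    then have 2: "(\<Sum>j\<in>dc_buses net. y j * u j) \<le>
        c / 2 * (\<Sum>j\<in>dc_buses net. (y j)\<^sup>2) + b * (\<Sum>j\<in>dc_buses net. (u j)\<^sup>2)"
      unfolding sum_distrib_left sum.distrib[symmetric] by (rule sum_mono)
    have "(\<Sum>j\<in>dc_buses net. y j * dc_inflow y j) =
        - (\<Sum>(i, j)\<in>dc_lines net. conductance net (i, j) * (y i - y j)\<^sup>2)"
      unfolding sum_dc_inflow sum_negf[symmetric]
      by (intro sum.cong) (auto simp: power2_eq_square algebra_simps)
    then show ?thesis
      using 1 2 coercive[of y] by (simp add: distrib_left sum.distrib)
  qed
  moreover have "a > 0" "b > 0" using c C by (auto simp: a_def b_def)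
  ultimately show ?thesis using that by blast
qed

lemma dc_energy_deriv:
  assumes "\<And>j. j \<in> dc_buses net \<Longrightarrow>
    ((\<lambda>s. Y s j) has_real_derivative (dc_inflow (Y t) j + u j) / capacitance net j) F"
    and F: "F = at t within {0..}"
  shows "((\<lambda>s. dc_energy (Y s)) has_real_derivative
    (\<Sum>j\<in>dc_buses net. Y t j * (dc_inflow (Y t) j + u j))) F"
  unfolding dc_energy_def
proof (rule DERIV_sum)
  fix j assume j: "j \<in> dc_buses net"
  show "((\<lambda>s. capacitance net j / 2 * (Y s j)\<^sup>2) has_real_derivative
      Y t j * (dc_inflow (Y t) j + u j)) F"
    using capacitance_pos[OF j] unfolding F
    by (auto intro!: derivative_eq_intros assms(1)[OF j, unfolded F])
qed

lemma dc_inflow_diff: "dc_inflow (\<lambda>j. y j - z j) j = dc_inflow y j - dc_inflow z j"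
  unfolding dc_inflow_def by (simp add: right_diff_distrib sum_subtractf)

text \<open>Input-to-state stability of the linear DC dynamics, with inputs and averages as
  disturbances. \<open>Y\<close> and \<open>u\<close> are arbitrary because the result is applied
  both to the voltages and to their increments over a time step.\<close>

lemma
  assumes Y: "\<And>t j. t \<ge> 0 \<Longrightarrow> j \<in> dc_buses net \<Longrightarrow>
    ((\<lambda>s. Y s j) has_real_derivative (dc_inflow (Y t) j + u t j) / capacitance net j) (at t within {0..})"
    and j: "j \<in> dc_buses net"
  shows dc_decay_bounded: "(\<And>j. j \<in> dc_buses net \<Longrightarrow> bounded_half_line (\<lambda>t. u t j)) \<Longrightarrow>
      (\<And>K. K \<in> dc_subs net \<Longrightarrow> bounded_half_line (\<lambda>t. \<Sum>j\<in>K. capacitance net j * Y t j)) \<Longrightarrow>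
      bounded_half_line (\<lambda>t. Y t j)"
    and dc_decay_tendsto: "(\<And>j. j \<in> dc_buses net \<Longrightarrow> ((\<lambda>t. u t j) \<longlongrightarrow> 0) at_top) \<Longrightarrow>
      (\<And>K. K \<in> dc_subs net \<Longrightarrow> ((\<lambda>t. \<Sum>j\<in>K. capacitance net j * Y t j) \<longlongrightarrow> 0) at_top) \<Longrightarrow>
      ((\<lambda>t. Y t j) \<longlongrightarrow> 0) at_top"
proof -
  obtain a b where "a > 0" "b > 0" and dissipation:
    "\<And>y u. (\<Sum>j\<in>dc_buses net. y j * (dc_inflow y j + u j)) \<le> - a * dc_energy y +
       ((\<Sum>K\<in>dc_subs net. (\<Sum>j\<in>K. capacitance net j * y j)\<^sup>2) + b * (\<Sum>j\<in>dc_buses net. (u j)\<^sup>2))"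
    by (rule dc_dissipation) blast
  define g where "g t = (\<Sum>K\<in>dc_subs net. (\<Sum>j\<in>K. capacitance net j * Y t j)\<^sup>2) +
    b * (\<Sum>j\<in>dc_buses net. (u t j)\<^sup>2)" for t
  note deriv = dc_energy_deriv[OF Y refl]
  have le: "(\<Sum>j\<in>dc_buses net. Y t j * (dc_inflow (Y t) j + u t j)) \<le> - a * dc_energy (Y t) + g t" for t
    unfolding g_def by (rule dissipation)
  have cj: "capacitance net j / 2 > 0" using capacitance_pos[OF j] by simp
  show "bounded_half_line (\<lambda>t. Y t j)"
    if "\<And>j. j \<in> dc_buses net \<Longrightarrow> bounded_half_line (\<lambda>t. u t j)"
      and "\<And>K. K \<in> dc_subs net \<Longrightarrow> bounded_half_line (\<lambda>t. \<Sum>j\<in>K. capacitance net j * Y t j)"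
  proof -
    have "bounded_half_line g"
      unfolding g_def power2_eq_square by (intro bounded_half_line_intros that)
    then obtain K where "\<And>t. t \<ge> 0 \<Longrightarrow> g t \<le> K"
      unfolding bounded_half_line_def by (meson abs_le_D1)
    then obtain B where "\<And>t. t \<ge> 0 \<Longrightarrow> dc_energy (Y t) \<le> B"
      using linear_decay_bounded[OF deriv le \<open>a > 0\<close>] by metis
    then have "capacitance net j / 2 * (Y t j)\<^sup>2 \<le> B" if "t \<ge> 0" for t
      using order_trans[OF dc_energy_ge[OF j]] that by blast
    then show ?thesis using cj by (rule bounded_half_line_of_square)
  qed
  show "((\<lambda>t. Y t j) \<longlongrightarrow> 0) at_top"
    if "\<And>j. j \<in> dc_buses net \<Longrightarrow> ((\<lambda>t. u t j) \<longlongrightarrow> 0) at_top"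
      and "\<And>K. K \<in> dc_subs net \<Longrightarrow> ((\<lambda>t. \<Sum>j\<in>K. capacitance net j * Y t j) \<longlongrightarrow> 0) at_top"
  proof -
    have "(g \<longlongrightarrow> (\<Sum>K\<in>dc_subs net. 0\<^sup>2) + b * (\<Sum>j\<in>dc_buses net. 0\<^sup>2)) at_top"
      unfolding g_def by (intro tendsto_intros that)
    then have g0: "(g \<longlongrightarrow> 0) at_top" by simp
    have energy: "((\<lambda>t. dc_energy (Y t)) \<longlongrightarrow> 0) at_top"
      by (rule linear_decay_tendsto[OF deriv le \<open>a > 0\<close> dc_energy_nonneg g0])
    have "norm (capacitance net j / 2 * (Y t j)\<^sup>2) \<le> dc_energy (Y t)" for t
      using dc_energy_ge[OF j, of "Y t"] cj by (simp add: abs_mult)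
    then have "((\<lambda>t. capacitance net j / 2 * (Y t j)\<^sup>2) \<longlongrightarrow> 0) at_top"
      by (rule Lim_null_comparison[OF always_eventually[OF allI] energy])
    then have "((\<lambda>t. (Y t j)\<^sup>2) \<longlongrightarrow> 0) at_top"
      using tendsto_0_cmult_iff[of "capacitance net j / 2" "\<lambda>t. (Y t j)\<^sup>2"] cj by simp
    then show ?thesis by (rule tendsto_0_of_square)
  qed
qed

end

subsection \<open>The Lyapunov function\<close>

text \<open>
  The Bregman distance of \<open>- cos\<close> between \<open>y\<close> and \<open>a\<close>; unlike \<open>- cos y\<close> it is minimal at \<open>a\<close>.
\<close>

definition angle_potential :: "real \<Rightarrow> real \<Rightarrow> real" where
  "angle_potential a y = cos a - cos y - sin a * (y - a)"

lemma angle_potential_self [simp]: "angle_potential a a = 0"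
  by (simp add: angle_potential_def)

text \<open>The derivative in the second argument is \<open>sin z - sin a\<close>, which has the
  sign of \<open>z - a\<close> wherever the sine is increasing; the mean value theorem does the
  rest.\<close>

lemma angle_potential_pos:
  assumes "\<bar>a\<bar> < pi / 2" "\<bar>y\<bar> < pi / 2" "y \<noteq> a"
  shows "angle_potential a y > 0"
proof -
  have deriv: "(angle_potential a has_real_derivative sin z - sin a) (at z)" for z
    unfolding angle_potential_def by (auto intro!: derivative_eq_intros)
  consider "a < y" | "y < a" using assms(3) by linarith
  then show ?thesis
  proof cases
    case 1
    then obtain z where z: "a < z" "z < y" "angle_potential a y - angle_potential a a = (y - a) * (sin z - sin a)"
      using MVT2[of a y "angle_potential a" "\<lambda>z. sin z - sin a"] deriv by blast
    then have "sin a < sin z" using assms by (subst sin_mono_less_eq) auto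
    then show ?thesis using z 1 by simp
  next
    case 2
    then obtain z where z: "y < z" "z < a" "angle_potential a a - angle_potential a y = (a - y) * (sin z - sin a)"
      using MVT2[of y a "angle_potential a" "\<lambda>z. sin z - sin a"] deriv by blast
    then have "sin z < sin a" using assms by (subst sin_mono_less_eq) auto
    then show ?thesis using z 2 mult_pos_neg[of "a - y" "sin z - sin a"] by simp
  qed
qed

lemma angle_potential_nonneg:
  "\<bar>a\<bar> < pi / 2 \<Longrightarrow> \<bar>y\<bar> < pi / 2 \<Longrightarrow> angle_potential a y \<ge> 0"
  using angle_potential_pos[of a y] by (cases "y = a") (auto intro: less_imp_le)

context hybrid_grid
begin

text \<open>A function of the state rather than of the point, since its sublevel sets must be open
  in the state space. The weights cancel the coefficients of the dynamics; \<open>gain net\<close>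
  makes each DC term contribute its power balance times the virtual frequency. Converter buses on
  the AC side have no inertia and no term.\<close>

definition lyapunov :: "'n point \<Rightarrow> 'n state \<Rightarrow> real" where
  "lyapunov vs = (\<lambda>(\<eta>, \<omega>, V, \<xi>).
     (\<Sum>j\<in>gen_buses net. inertia net j / 2 * (\<omega> $ j)\<^sup>2) +
     (\<Sum>e\<in>ac_lines net. susceptance net e * angle_potential (angle vs e) (\<eta> $ e)) +
     (\<Sum>K\<in>dc_subs net. gain net / 2 * (\<Sum>j\<in>K. capacitance net j * V $ j)\<^sup>2) +
     (\<Sum>i\<in>UNIV. time_const net $ i $ i / 2 * (\<xi> $ i - sync vs $ i)\<^sup>2))"

lemma lyapunov_state_of:
  "lyapunov vs (state_of net v) =
     (\<Sum>j\<in>gen_buses net. inertia net j / 2 * (freq v j)\<^sup>2) +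
     (\<Sum>e\<in>ac_lines net. susceptance net e * angle_potential (angle vs e) (angle v e)) +
     (\<Sum>K\<in>dc_subs net. gain net / 2 * (avg_volt net v K)\<^sup>2) +
     (\<Sum>i\<in>UNIV. time_const net $ i $ i / 2 * (sync v $ i - sync vs $ i)\<^sup>2)"
proof -
  have "(\<Sum>j\<in>K. capacitance net j * (if j \<in> dc_buses net then volt v j else 0)) = avg_volt net v K"
    if "K \<in> dc_subs net" for K
    unfolding avg_volt_def using dc_sub_subset[OF that] by (intro sum.cong) auto
  then show ?thesis by (simp add: lyapunov_def state_of_def)
qed

lemma continuous_lyapunov: "continuous_on UNIV (lyapunov vs)"
  unfolding lyapunov_def angle_potential_def case_prod_beta by (intro continuous_intros)

lemma lyapunov_equilibrium:
  assumes "equilibrium net vs" shows "lyapunov vs (state_of net vs) = 0"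
  using equilibrium_freq[OF assms] equilibrium_avg_volt[OF assms]
  by (simp add: lyapunov_state_of gen_buses_def)

text \<open>Small angles make every summand nonnegative, so the total bounds each of them. Decrease
  of the function thereby yields bounds on frequencies, averages and communicated variables, and a
  barrier for the angles.\<close>

lemma lyapunov_ge:
  assumes "\<And>e. e \<in> ac_lines net \<Longrightarrow> \<bar>angle vs e\<bar> < pi / 2 \<and> \<bar>angle v e\<bar> < pi / 2"
  shows "lyapunov vs (state_of net v) \<ge> 0"
    and "j \<in> gen_buses net \<Longrightarrow> inertia net j / 2 * (freq v j)\<^sup>2 \<le> lyapunov vs (state_of net v)"
    and "e \<in> ac_lines net \<Longrightarrow> susceptance net e * angle_potential (angle vs e) (angle v e)
           \<le> lyapunov vs (state_of net v)"
    and "K \<in> dc_subs net \<Longrightarrow> gain net / 2 * (avg_volt net v K)\<^sup>2 \<le> lyapunov vs (state_of net v)"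
    and "time_const net $ i $ i / 2 * (sync v $ i - sync vs $ i)\<^sup>2 \<le> lyapunov vs (state_of net v)"
proof -
  have 1: "inertia net j / 2 * (freq v j)\<^sup>2 \<ge> 0" if "j \<in> gen_buses net" for j
    using inertia_pos[OF that] by simp
  have 2: "susceptance net e * angle_potential (angle vs e) (angle v e) \<ge> 0" if "e \<in> ac_lines net" for e
    using susceptance_pos[OF that] assms[OF that] by (simp add: angle_potential_nonneg)
  have 3: "gain net / 2 * (avg_volt net v K)\<^sup>2 \<ge> 0" for K
    using gain_pos by simp
  have 4: "time_const net $ i $ i / 2 * (sync v $ i - sync vs $ i)\<^sup>2 \<ge> 0" for i
    using time_const_pos[of i] by simp
  have nonneg: "(\<Sum>j\<in>gen_buses net. inertia net j / 2 * (freq v j)\<^sup>2) \<ge> 0"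
    "(\<Sum>e\<in>ac_lines net. susceptance net e * angle_potential (angle vs e) (angle v e)) \<ge> 0"
    "(\<Sum>K\<in>dc_subs net. gain net / 2 * (avg_volt net v K)\<^sup>2) \<ge> 0"
    "(\<Sum>i\<in>UNIV. time_const net $ i $ i / 2 * (sync v $ i - sync vs $ i)\<^sup>2) \<ge> 0"
    by (rule sum_nonneg, (rule 1 2 3 4)?, assumption?)+
  show "lyapunov vs (state_of net v) \<ge> 0"
    unfolding lyapunov_state_of using nonneg by linarith
  show "inertia net j / 2 * (freq v j)\<^sup>2 \<le> lyapunov vs (state_of net v)" if "j \<in> gen_buses net"
    using member_le_sum[OF that, of "\<lambda>j. inertia net j / 2 * (freq v j)\<^sup>2"] 1 nonneg
    unfolding lyapunov_state_of by simp
  show "susceptance net e * angle_potential (angle vs e) (angle v e) \<le> lyapunov vs (state_of net v)"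
    if "e \<in> ac_lines net"
    using member_le_sum[OF that, of "\<lambda>e. susceptance net e * angle_potential (angle vs e) (angle v e)"] 2 nonneg
    unfolding lyapunov_state_of by simp
  show "gain net / 2 * (avg_volt net v K)\<^sup>2 \<le> lyapunov vs (state_of net v)" if "K \<in> dc_subs net"
    using member_le_sum[OF that, of "\<lambda>K. gain net / 2 * (avg_volt net v K)\<^sup>2"] 3 nonneg
    unfolding lyapunov_state_of by simp
  show "time_const net $ i $ i / 2 * (sync v $ i - sync vs $ i)\<^sup>2 \<le> lyapunov vs (state_of net v)"
    using member_le_sum[of i UNIV "\<lambda>i. time_const net $ i $ i / 2 * (sync v $ i - sync vs $ i)\<^sup>2"] 4 nonneg
    unfolding lyapunov_state_of by simp
qed

definition dissipation :: "'n point \<Rightarrow> real" where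
  "dissipation v = (\<Sum>j\<in>gen_buses net. damping net j * (freq v j)\<^sup>2) +
     1 / 2 * (\<Sum>(i, j)\<in>comm net. (sync v $ i - sync v $ j)\<^sup>2)"

definition dc_input :: "'n point \<Rightarrow> 'n \<Rightarrow> real" where
  "dc_input v j = gen v $ j - load net $ j - conv v j"

lemma dc_balance:
  "j \<in> dc_buses net \<Longrightarrow> net_power net v j - conv v j = dc_inflow (volt v) j + dc_input v j"
  by (simp add: dc_net_power dc_inflow_def dc_input_def)

text \<open>The equilibrium values of \<open>sync\<close> are all equal, so the Laplacian form does
  not notice the shift by \<open>sync vs\<close>; only the coupling to the virtual frequency retains
  it.\<close>

lemma sync_term:
  assumes "equilibrium net vs"
  shows "(\<Sum>i\<in>UNIV. (sync v $ i - sync vs $ i) * sync_rate net v $ i) =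
    - (1 / 2 * (\<Sum>(i, j)\<in>comm net. (sync v $ i - sync v $ j)\<^sup>2)) -
    (\<Sum>i\<in>UNIV. virtual_freq net v $ i * cost_recip i * (sync v $ i - sync vs $ i))"
proof -
  let ?u = "sync v - sync vs"
  have "(\<Sum>i\<in>UNIV. (sync v $ i - sync vs $ i) * sync_rate net v $ i) =
      - (?u \<bullet> (laplacian (comm net) *v sync v)) -
      (\<Sum>i\<in>UNIV. virtual_freq net v $ i * cost_recip i * (sync v $ i - sync vs $ i))"
    by (simp add: inner_vec_def sync_rate_def cost_inv_mult_nth sum_negf[symmetric]
        sum_subtractf[symmetric] algebra_simps)
  also have "?u \<bullet> (laplacian (comm net) *v sync v) =
      1 / 2 * (\<Sum>(i, j)\<in>comm net. (sync v $ i - sync v $ j)\<^sup>2)"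
  proof -
    have "(?u $ i - ?u $ j) * (sync v $ i - sync v $ j) = (sync v $ i - sync v $ j)\<^sup>2" for i j
      using equilibrium_sync[OF assms, of i j] by (simp add: power2_eq_square)
    then show ?thesis by (simp only: laplacian_form[OF sym_comm irrefl_comm])
  qed
  finally show ?thesis .
qed

text \<open>
  Both power balances are tested against the virtual frequencies of \<open>v\<close>, which agree across
  converters and DC lines, so the converter powers and the DC flows drop out.
\<close>

lemma dissipation_identity:
  assumes alg: "algebraic_relations net v" and eq: "equilibrium net vs"
  shows "(\<Sum>j\<in>gen_buses net. freq v j * (net_power net v j - damping net j * freq v j)) +
    (\<Sum>(i, j)\<in>ac_lines net. susceptance net (i, j) * (sin (angle v (i, j)) - sin (angle vs (i, j)))
       * (freq v i - freq v j)) +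
    (\<Sum>K\<in>dc_subs net. gain net * avg_volt net v K * (\<Sum>j\<in>K. dc_input v j)) +
    (\<Sum>i\<in>UNIV. (sync v $ i - sync vs $ i) * sync_rate net v $ i) = - dissipation v"
proof -
  let ?w = "\<lambda>j. virtual_freq net v $ j" and ?b = "\<lambda>v j. net_power net v j - conv v j"
  let ?flow = "\<lambda>v. \<Sum>(i, j)\<in>ac_lines net. susceptance net (i, j) * sin (angle v (i, j)) * (?w j - ?w i)"
  have balance: "(\<Sum>j\<in>UNIV. ?w j * ?b v' j) = (\<Sum>j\<in>UNIV. ?w j * (gen v' $ j - load net $ j)) + ?flow v'"
    if "algebraic_relations net v'" for v'
    by (rule sum_power_balance[OF that virtual_freq_ilc[OF alg] virtual_freq_dc_line])
  \<comment> \<open>The balance at \<open>vs\<close> holds bus by bus, hence also against the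
    foreign weights of \<open>v\<close>. Subtracting it eliminates the loads and produces
    differences to the equilibrium.\<close>
  have "(\<Sum>j\<in>UNIV. ?w j * ?b vs j) = 0"
    using equilibrium_power_balance[OF eq] by simp
  then have "(\<Sum>j\<in>UNIV. ?w j * ?b v j) = (\<Sum>j\<in>UNIV. ?w j * (gen v $ j - load net $ j)) + ?flow v -
      ((\<Sum>j\<in>UNIV. ?w j * (gen vs $ j - load net $ j)) + ?flow vs)"
    using balance[OF alg] balance[OF equilibrium_algebraic[OF eq]] by simp
  also have "\<dots> = (\<Sum>j\<in>UNIV. ?w j * (gen v $ j - gen vs $ j)) + (?flow v - ?flow vs)"
    by (simp add: right_diff_distrib sum_subtractf)
  also have "(\<Sum>j\<in>UNIV. ?w j * (gen v $ j - gen vs $ j)) =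
      (\<Sum>j\<in>UNIV. ?w j * cost_recip j * (sync v $ j - sync vs $ j))"
    by (simp add: gen_nth[OF alg] gen_nth[OF equilibrium_algebraic[OF eq]] algebra_simps)
  also have "?flow v - ?flow vs = - (\<Sum>(i, j)\<in>ac_lines net. susceptance net (i, j) *
      (sin (angle v (i, j)) - sin (angle vs (i, j))) * (freq v i - freq v j))"
    unfolding sum_negf[symmetric] sum_subtractf[symmetric]
    by (intro sum.cong) (auto simp: virtual_freq_ac dest!: ac_lineD, simp add: algebra_simps)
  finally have total: "(\<Sum>j\<in>UNIV. ?w j * ?b v j) =
      (\<Sum>j\<in>UNIV. ?w j * cost_recip j * (sync v $ j - sync vs $ j)) -
      (\<Sum>(i, j)\<in>ac_lines net. susceptance net (i, j) *
      (sin (angle v (i, j)) - sin (angle vs (i, j))) * (freq v i - freq v j))"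
    by simp
  have "(\<Sum>j\<in>gen_buses net. freq v j * (net_power net v j - damping net j * freq v j)) =
      (\<Sum>j\<in>gen_buses net. ?w j * ?b v j) - (\<Sum>j\<in>gen_buses net. damping net j * (freq v j)\<^sup>2)"
    unfolding sum_subtractf[symmetric]
  proof (intro sum.cong refl)
    fix j assume j: "j \<in> gen_buses net"
    then have "conv v j = 0"
      by (rule conv_no_ilc[OF alg gen_buses_not_ilc])
    then show "freq v j * (net_power net v j - damping net j * freq v j) =
        ?w j * ?b v j - damping net j * (freq v j)\<^sup>2"
      using j by (simp add: gen_buses_def virtual_freq_ac power2_eq_square algebra_simps)
  qed
  \<comment> \<open>AC buses with converters have no term in the Lyapunov function; their algebraic
    balance makes their share of the total zero as well.\<close>
  moreover have "(\<Sum>j\<in>x_ac net. ?w j * ?b v j) = 0"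
    using alg by (intro sum.neutral) (auto simp: algebraic_relations_def)
  moreover have "(\<Sum>K\<in>dc_subs net. gain net * avg_volt net v K * (\<Sum>j\<in>K. dc_input v j)) =
      (\<Sum>j\<in>dc_buses net. ?w j * ?b v j)"
    unfolding sum_dc_buses
  proof (intro sum.cong refl)
    fix K assume K: "K \<in> dc_subs net"
    have "(\<Sum>j\<in>K. ?w j * ?b v j) =
        (\<Sum>j\<in>K. gain net * avg_volt net v K * (dc_inflow (volt v) j + dc_input v j))"
      using dc_sub_subset[OF K] by (intro sum.cong refl) (auto simp: virtual_freq_dc[OF K] dc_balance)
    also have "\<dots> = gain net * avg_volt net v K * (\<Sum>j\<in>K. dc_input v j)"
      by (simp add: sum_distrib_left[symmetric] sum.distrib sum_dc_inflow_sub[OF K])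
    finally show "gain net * avg_volt net v K * (\<Sum>j\<in>K. dc_input v j) = (\<Sum>j\<in>K. ?w j * ?b v j)" ..
  qed
  ultimately show ?thesis
    using total sum_UNIV_split[of "\<lambda>j. ?w j * ?b v j"]
    by (simp add: sync_term[OF eq] dissipation_def)
qed

end

locale closed_loop = hybrid_grid net for net :: "'n::finite network" +
  fixes vs :: "'n point" and x :: "real \<Rightarrow> 'n point"
  assumes eq: "equilibrium net vs" and solution: "closed_loop_solution net x"
begin

section \<open>Derivatives along a solution\<close>

lemma algebraic: "t \<ge> 0 \<Longrightarrow> algebraic_relations net (x t)"
  using solution by (simp add: closed_loop_solution_def)

lemma angle_deriv:
  assumes "t \<ge> 0" "(i, j) \<in> ac_lines net"
  shows "((\<lambda>s. angle (x s) (i, j)) has_real_derivative freq (x t) i - freq (x t) j) (at t within {0..})"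
  using solution assms unfolding closed_loop_solution_def by blast

lemma freq_deriv:
  assumes "t \<ge> 0" "j \<in> gen_buses net"
  shows "((\<lambda>s. freq (x s) j) has_real_derivative
    (net_power net (x t) j - damping net j * freq (x t) j) / inertia net j) (at t within {0..})"
proof -
  obtain r where "((\<lambda>s. freq (x s) j) has_real_derivative r) (at t within {0..})"
    and r: "inertia net j * r = net_power net (x t) j - damping net j * freq (x t) j"
    using solution assms unfolding closed_loop_solution_def by blast
  moreover have "r = (net_power net (x t) j - damping net j * freq (x t) j) / inertia net j"
    using inertia_pos[OF assms(2)] by (simp add: r[symmetric])
  ultimately show ?thesis by simp
qed

lemma volt_deriv:
  assumes "t \<ge> 0" "j \<in> dc_buses net"
  shows "((\<lambda>s. volt (x s) j) has_real_derivative
    (dc_inflow (volt (x t)) j + dc_input (x t) j) / capacitance net j) (at t within {0..})"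
proof -
  obtain r where "((\<lambda>s. volt (x s) j) has_real_derivative r) (at t within {0..})"
    and r: "capacitance net j * r = net_power net (x t) j - conv (x t) j"
    using solution assms unfolding closed_loop_solution_def by blast
  moreover have "r = (dc_inflow (volt (x t)) j + dc_input (x t) j) / capacitance net j"
    using capacitance_pos[OF assms(2)] by (simp add: r[symmetric] dc_balance[OF assms(2), symmetric])
  ultimately show ?thesis by simp
qed

text \<open>The capacitance weights cancel the divisors of the voltage equations, and the line flows
  inside a subsystem sum to zero, so the average responds to the inputs alone.\<close>

lemma avg_volt_deriv:
  assumes "t \<ge> 0" "K \<in> dc_subs net"
  shows "((\<lambda>s. avg_volt net (x s) K) has_real_derivative (\<Sum>j\<in>K. dc_input (x t) j)) (at t within {0..})"
proof -
  have "((\<lambda>s. avg_volt net (x s) K) has_real_derivative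
      (\<Sum>j\<in>K. dc_inflow (volt (x t)) j + dc_input (x t) j)) (at t within {0..})"
    unfolding avg_volt_def
  proof (rule DERIV_sum)
    fix j assume "j \<in> K"
    then have j: "j \<in> dc_buses net" using dc_sub_subset[OF assms(2)] by auto
    from DERIV_cmult[OF volt_deriv[OF assms(1) j], of "capacitance net j"]
    show "((\<lambda>s. capacitance net j * volt (x s) j) has_real_derivative
        dc_inflow (volt (x t)) j + dc_input (x t) j) (at t within {0..})"
      using capacitance_pos[OF j] by simp
  qed
  then show ?thesis by (simp add: sum.distrib sum_dc_inflow_sub[OF assms(2)])
qed

lemma sync_deriv:
  assumes "t \<ge> 0"
  shows "((\<lambda>s. sync (x s) $ i) has_real_derivative sync_rate net (x t) $ i / time_const net $ i $ i)
    (at t within {0..})"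
proof -
  obtain r where r: "((\<lambda>s. sync (x s)) has_vector_derivative r) (at t within {0..})"
    "time_const net *v r = sync_rate net (x t)"
    using solution assms unfolding closed_loop_solution_def by blast
  have "((\<lambda>s. sync (x s) $ i) has_vector_derivative r $ i) (at t within {0..})"
    by (rule bounded_linear.has_vector_derivative[OF bounded_linear_vec_nth r(1)])
  moreover have "r $ i = sync_rate net (x t) $ i / time_const net $ i $ i"
    using time_const_pos[of i]
    by (simp add: r(2)[symmetric] diag_mult_nth[of "time_const net", OF time_const_diag])
  ultimately show ?thesis by (simp add: has_real_derivative_iff_has_vector_derivative)
qed

lemma lyapunov_deriv:
  assumes t: "t \<ge> 0"
  shows "((\<lambda>s. lyapunov vs (state_of net (x s))) has_real_derivative - dissipation (x t)) (at t within {0..})"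
proof -
  let ?F = "at t within {0..}"
  have "((\<lambda>s. \<Sum>j\<in>gen_buses net. inertia net j / 2 * (freq (x s) j)\<^sup>2) has_real_derivative
      (\<Sum>j\<in>gen_buses net. freq (x t) j * (net_power net (x t) j - damping net j * freq (x t) j))) ?F"
  proof (rule DERIV_sum)
    fix j assume j: "j \<in> gen_buses net"
    show "((\<lambda>s. inertia net j / 2 * (freq (x s) j)\<^sup>2) has_real_derivative
      freq (x t) j * (net_power net (x t) j - damping net j * freq (x t) j)) ?F"
      using inertia_pos[OF j] by (auto intro!: derivative_eq_intros freq_deriv[OF t j])
  qed
  moreover have "((\<lambda>s. \<Sum>e\<in>ac_lines net. susceptance net e * angle_potential (angle vs e) (angle (x s) e))
      has_real_derivative (\<Sum>(i, j)\<in>ac_lines net. susceptance net (i, j) *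
        (sin (angle (x t) (i, j)) - sin (angle vs (i, j))) * (freq (x t) i - freq (x t) j))) ?F"
  proof (rule DERIV_sum)
    fix e assume e: "e \<in> ac_lines net"
    obtain i j where ij: "e = (i, j)" by fastforce
    show "((\<lambda>s. susceptance net e * angle_potential (angle vs e) (angle (x s) e)) has_real_derivative
      (case e of (i, j) \<Rightarrow> susceptance net (i, j) *
        (sin (angle (x t) (i, j)) - sin (angle vs (i, j))) * (freq (x t) i - freq (x t) j))) ?F"
      unfolding angle_potential_def ij
      by (auto intro!: derivative_eq_intros angle_deriv[OF t e[unfolded ij]] simp: algebra_simps)
  qed
  moreover have "((\<lambda>s. \<Sum>K\<in>dc_subs net. gain net / 2 * (avg_volt net (x s) K)\<^sup>2) has_real_derivative
      (\<Sum>K\<in>dc_subs net. gain net * avg_volt net (x t) K * (\<Sum>j\<in>K. dc_input (x t) j))) ?F"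
  proof (rule DERIV_sum)
    fix K assume K: "K \<in> dc_subs net"
    show "((\<lambda>s. gain net / 2 * (avg_volt net (x s) K)\<^sup>2) has_real_derivative
      gain net * avg_volt net (x t) K * (\<Sum>j\<in>K. dc_input (x t) j)) ?F"
      by (auto intro!: derivative_eq_intros avg_volt_deriv[OF t K])
  qed
  moreover have "((\<lambda>s. \<Sum>i\<in>UNIV. time_const net $ i $ i / 2 * (sync (x s) $ i - sync vs $ i)\<^sup>2)
      has_real_derivative (\<Sum>i\<in>UNIV. (sync (x t) $ i - sync vs $ i) * sync_rate net (x t) $ i)) ?F"
  proof (rule DERIV_sum)
    fix i
    show "((\<lambda>s. time_const net $ i $ i / 2 * (sync (x s) $ i - sync vs $ i)\<^sup>2) has_real_derivative
      (sync (x t) $ i - sync vs $ i) * sync_rate net (x t) $ i) ?F"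
      using time_const_pos[of i] by (auto intro!: derivative_eq_intros sync_deriv[OF t])
  qed
  ultimately show ?thesis
    unfolding lyapunov_state_of dissipation_identity[OF algebraic[OF t] eq, symmetric]
    by (intro DERIV_add)
qed

lemma dissipation_nonneg: "dissipation v \<ge> 0"
  unfolding dissipation_def using damping_pos
  by (intro add_nonneg_nonneg mult_nonneg_nonneg sum_nonneg) (auto simp: less_imp_le)

lemma lyapunov_decreasing:
  "0 \<le> s \<Longrightarrow> s \<le> t \<Longrightarrow> lyapunov vs (state_of net (x t)) \<le> lyapunov vs (state_of net (x s))"
  using decreasing_half_line[OF lyapunov_deriv, of 0 s t] dissipation_nonneg by simp

text \<open>
  The set of times at which all angles lie strictly within \<open>d\<close> of the equilibrium is open; since
  the Lyapunov function stays below its minimum \<open>c\<close> on the boundary, it is closed as well.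
\<close>

lemma trapped:
  assumes d: "\<And>e. e \<in> ac_lines net \<Longrightarrow> \<bar>angle vs e\<bar> + d < pi / 2"
    and c: "\<And>e y. e \<in> ac_lines net \<Longrightarrow> \<bar>y - angle vs e\<bar> = d \<Longrightarrow>
      c \<le> susceptance net e * angle_potential (angle vs e) y"
    and init: "\<And>e. e \<in> ac_lines net \<Longrightarrow> \<bar>angle (x 0) e - angle vs e\<bar> < d"
      "lyapunov vs (state_of net (x 0)) < c"
    and "t \<ge> 0" "e \<in> ac_lines net"
  shows "\<bar>angle (x t) e - angle vs e\<bar> < d"
proof -
  define f where "f t = (\<chi> e. if e \<in> ac_lines net then angle (x t) e - angle vs e else 0)" for t
  define G where "G = {t \<in> {0..}. \<forall>e\<in>ac_lines net. \<bar>angle (x t) e - angle vs e\<bar> < d}"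
  define A where "A = (\<Inter>e\<in>ac_lines net. {z :: real ^ ('n \<times> 'n). \<bar>z $ e\<bar> < d})"
  define B where "B = (\<Inter>e\<in>ac_lines net. {z :: real ^ ('n \<times> 'n). \<bar>z $ e\<bar> \<le> d})"
  have angle: "continuous_on {0..} (\<lambda>t. angle (x t) (i, j))" if "(i, j) \<in> ac_lines net" for i j
    using that by (auto intro!: DERIV_continuous_on angle_deriv)
  have f: "continuous_on {0..} f"
    unfolding f_def
  proof (intro continuous_on_vec_lambda)
    fix e
    show "continuous_on {0..} (\<lambda>t. if e \<in> ac_lines net then angle (x t) e - angle vs e else 0)"
      by (cases e, cases "e \<in> ac_lines net") (auto intro!: continuous_on_diff angle)
  qed
  have "open A" unfolding A_def
    by (intro open_INT ballI open_Collect_less continuous_intros) auto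
  then have "openin (top_of_set {0..}) ({0..} \<inter> f -` A)"
    by (rule continuous_openin_preimage_gen[OF f])
  moreover have "{0..} \<inter> f -` A = G" by (auto simp: G_def A_def f_def)
  ultimately have "openin (top_of_set {0..}) G" by simp
  have "closed B" unfolding B_def
    by (intro closed_INT ballI closed_Collect_le continuous_intros)
  then have "closedin (top_of_set {0..}) ({0..} \<inter> f -` B)"
    by (rule continuous_closedin_preimage[OF f])
  moreover have "{0..} \<inter> f -` B = G"
  proof -
    have "\<bar>angle (x t) e - angle vs e\<bar> < d"
      if t: "t \<ge> 0" and le: "\<And>e. e \<in> ac_lines net \<Longrightarrow> \<bar>angle (x t) e - angle vs e\<bar> \<le> d"
        and e: "e \<in> ac_lines net" for t e
    proof (rule ccontr)
      assume "\<not> \<bar>angle (x t) e - angle vs e\<bar> < d"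
      then have "c \<le> susceptance net e * angle_potential (angle vs e) (angle (x t) e)"
        using le[OF e] by (intro c[OF e]) auto
      also have "\<dots> \<le> lyapunov vs (state_of net (x t))"
      proof (rule lyapunov_ge(3)[OF _ e])
        show "\<bar>angle vs e\<bar> < pi / 2 \<and> \<bar>angle (x t) e\<bar> < pi / 2" if "e \<in> ac_lines net" for e
          using d[OF that] le[OF that] by linarith
      qed
      also have "\<dots> < c" using lyapunov_decreasing[of 0 t] t init(2) by simp
      finally show False by simp
    qed
    then show ?thesis by (auto simp: G_def B_def f_def less_imp_le)
  qed
  ultimately have "closedin (top_of_set {0..}) G" by simp
  moreover have "0 \<in> G" using init(1) by (simp add: G_def)
  moreover have "connected {0::real..}" by simp
  ultimately have "G = {0..}"
    using \<open>openin (top_of_set {0..}) G\<close> unfolding connected_clopen by blast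
  then show ?thesis using assms(5,6) by (auto simp: G_def)
qed

end

subsection \<open>Convergence of trapped solutions\<close>

text \<open>The outcome of \<open>trapped\<close> becomes an assumption, so the asymptotic analysis
  is independent of how the neighbourhood was chosen. Together \<open>margin\<close> and
  \<open>near\<close> keep all angles where the terms of the Lyapunov function are
  nonnegative.\<close>

locale trapped_solution = closed_loop net vs x
  for net :: "'n::finite network" and vs :: "'n point" and x :: "real \<Rightarrow> 'n point" +
  fixes d :: real
  assumes margin: "\<And>e. e \<in> ac_lines net \<Longrightarrow> \<bar>angle vs e\<bar> + d < pi / 2"
    and near: "\<And>t e. t \<ge> 0 \<Longrightarrow> e \<in> ac_lines net \<Longrightarrow> \<bar>angle (x t) e - angle vs e\<bar> < d"
begin

section \<open>Bounds along a trapped solution\<close>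

abbreviation energy :: "real \<Rightarrow> real" where
  "energy t \<equiv> lyapunov vs (state_of net (x t))"

lemma angle_small:
  assumes "t \<ge> 0" "e \<in> ac_lines net"
  shows "\<bar>angle vs e\<bar> < pi / 2 \<and> \<bar>angle (x t) e\<bar> < pi / 2"
  using margin[OF assms(2)] near[OF assms] by linarith

lemma energy_nonneg: "t \<ge> 0 \<Longrightarrow> energy t \<ge> 0"
  using lyapunov_ge(1) angle_small by blast

lemma energy_le: "t \<ge> 0 \<Longrightarrow> energy t \<le> energy 0"
  using lyapunov_decreasing[of 0 t] by simp

lemma bounded_angle: "e \<in> ac_lines net \<Longrightarrow> bounded_half_line (\<lambda>t. angle (x t) e)"
  using angle_small by (intro bounded_half_lineI[of _ "pi / 2"]) (simp add: less_imp_le)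

lemma bounded_gen_freq:
  assumes "j \<in> gen_buses net" shows "bounded_half_line (\<lambda>t. freq (x t) j)"
proof (rule bounded_half_line_of_square)
  show "inertia net j / 2 * (freq (x t) j)\<^sup>2 \<le> energy 0" if "t \<ge> 0" for t
    using lyapunov_ge(2)[of vs "x t" j] angle_small[OF that] assms energy_le[OF that] by force
qed (use inertia_pos[OF assms] in simp)

lemma bounded_avg_volt:
  assumes "K \<in> dc_subs net" shows "bounded_half_line (\<lambda>t. avg_volt net (x t) K)"
proof (rule bounded_half_line_of_square)
  show "gain net / 2 * (avg_volt net (x t) K)\<^sup>2 \<le> energy 0" if "t \<ge> 0" for t
    using lyapunov_ge(4)[of vs "x t" K] angle_small[OF that] assms energy_le[OF that] by force
qed (use gain_pos in simp)

lemma bounded_sync: "bounded_half_line (\<lambda>t. sync (x t) $ i)"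
proof -
  have "bounded_half_line (\<lambda>t. sync (x t) $ i - sync vs $ i)"
  proof (rule bounded_half_line_of_square)
    show "time_const net $ i $ i / 2 * (sync (x t) $ i - sync vs $ i)\<^sup>2 \<le> energy 0" if "t \<ge> 0" for t
      using lyapunov_ge(5)[of vs "x t" i] angle_small[OF that] energy_le[OF that] by force
  qed (use time_const_pos[of i] in simp)
  from bounded_half_line_add[OF this bounded_half_line_const[of "sync vs $ i"]] show ?thesis by simp
qed

text \<open>An AC bus with a converter has no differential equation for its frequency. The control
  law replaces it by a scaled average voltage, so that each virtual frequency is one of two
  quantities bounded by the energy.\<close>

lemma virtual_freq_cases:
  obtains "j \<in> gen_buses net" "\<And>v. virtual_freq net v $ j = freq v j"
  | K where "K \<in> dc_subs net" "\<And>t. t \<ge> 0 \<Longrightarrow> virtual_freq net (x t) $ j = gain net * avg_volt net (x t) K"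
proof (cases "j \<in> gen_buses net")
  case True
  then show ?thesis using that(1) by (simp add: virtual_freq_ac gen_buses_def)
next
  case False
  show ?thesis
  proof (cases "j \<in> dc_buses net")
    case True
    then obtain K where "K \<in> dc_subs net" "j \<in> K" by (auto simp: dc_buses_def)
    then show ?thesis using that(2)[of K] virtual_freq_dc by blast
  next
    case not_dc: False
    then have "j \<in> x_ac net" using False UNIV_split(1) by blast
    then obtain k where k: "(j, k) \<in> ilcs net" by (auto simp: x_ac_def)
    then obtain K where "K \<in> dc_subs net" "k \<in> K"
      using ilcs_subset by (auto simp: dc_buses_def)
    then show ?thesis
      using that(2)[of K] virtual_freq_ilc[OF algebraic k] virtual_freq_dc by simp
  qed
qed

text \<open>Converter powers have no dynamics either. The algebraic balance expresses them by the
  net power of an AC bus, which involves only angles and communicated variables; this avoids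
  circularity with the voltages, whose bound depends on the converter powers.\<close>

lemma conv_cases:
  obtains "\<And>t. t \<ge> 0 \<Longrightarrow> conv (x t) j = 0"
  | i where "i \<in> ac_buses net" "\<And>t. t \<ge> 0 \<Longrightarrow> conv (x t) j = net_power net (x t) i"
  | i where "i \<in> ac_buses net" "\<And>t. t \<ge> 0 \<Longrightarrow> conv (x t) j = - net_power net (x t) i"
proof -
  consider "j \<in> x_ac net" | "j \<in> x_dc net" | "j \<notin> x_ac net \<union> x_dc net" by blast
  then show ?thesis
  proof cases
    case 1
    then show ?thesis using that(2)[of j] conv_x_ac[OF algebraic] x_ac_subset by auto
  next
    case 2
    then obtain i where i: "(i, j) \<in> ilcs net" by (auto simp: x_dc_def)
    then have "i \<in> x_ac net" by (force simp: x_ac_def)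
    have conv: "conv (x t) j = - net_power net (x t) i" if "t \<ge> 0" for t
    proof -
      show ?thesis
        using conv_ilc[OF algebraic[OF that] i] conv_x_ac[OF algebraic[OF that] \<open>i \<in> x_ac net\<close>] by simp
    qed
    have "i \<in> ac_buses net" using \<open>i \<in> x_ac net\<close> x_ac_subset by blast
    from that(3)[OF this conv] show ?thesis .
  next
    case 3
    then show ?thesis using that(1) conv_no_ilc[OF algebraic] by simp
  qed
qed

lemma bounded_virtual_freq: "bounded_half_line (\<lambda>t. virtual_freq net (x t) $ j)"
proof (cases j rule: virtual_freq_cases)
  case 1
  then show ?thesis using bounded_gen_freq by simp
next
  case (2 K)
  then have "bounded_half_line (\<lambda>t. gain net * avg_volt net (x t) K)"
    by (intro bounded_half_line_intros bounded_avg_volt)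
  with 2 show ?thesis by (subst bounded_half_line_cong) auto
qed

lemma bounded_gen: "bounded_half_line (\<lambda>t. gen (x t) $ j)"
proof -
  have "bounded_half_line (\<lambda>t. cost_recip j * sync (x t) $ j)"
    by (intro bounded_half_line_intros bounded_sync)
  then show ?thesis
    by (subst bounded_half_line_cong) (auto simp: gen_nth[OF algebraic])
qed

lemma bounded_ac_power: "j \<in> ac_buses net \<Longrightarrow> bounded_half_line (\<lambda>t. net_power net (x t) j)"
  unfolding ac_net_power by (intro bounded_half_line_intros bounded_gen)

lemma bounded_conv: "bounded_half_line (\<lambda>t. conv (x t) j)"
proof (cases j rule: conv_cases)
  case 1
  then show ?thesis by (subst bounded_half_line_cong[of _ "\<lambda>_. 0"]) auto
next
  case (2 i)
  then show ?thesis using bounded_ac_power by (subst bounded_half_line_cong) auto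
next
  case (3 i)
  then show ?thesis using bounded_half_line_uminus[OF bounded_ac_power]
    by (subst bounded_half_line_cong) auto
qed

lemma bounded_dc_input: "bounded_half_line (\<lambda>t. dc_input (x t) j)"
  unfolding dc_input_def by (intro bounded_half_line_intros bounded_gen bounded_conv)

lemma bounded_sync_rate: "bounded_half_line (\<lambda>t. sync_rate net (x t) $ i)"
  unfolding sync_rate_nth by (intro bounded_half_line_intros bounded_sync bounded_virtual_freq)

lemma ac_freq_bounded: "j \<in> ac_buses net \<Longrightarrow> bounded_half_line (\<lambda>t. freq (x t) j)"
  using bounded_virtual_freq[of j] by (simp add: virtual_freq_ac)

section \<open>Lipschitz bounds for the state and its rates\<close>

lemma lipschitz_angle:
  assumes "e \<in> ac_lines net" shows "bounded_lipschitz (\<lambda>t. angle (x t) e)"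
proof -
  obtain i j where e: "e = (i, j)" by fastforce
  show ?thesis unfolding e
    using assms ac_lineD[of i j] unfolding e
    by (intro bounded_lipschitz_derivative[OF angle_deriv] bounded_angle bounded_half_line_diff ac_freq_bounded) auto
qed

lemma lipschitz_gen_freq: "j \<in> gen_buses net \<Longrightarrow> bounded_lipschitz (\<lambda>t. freq (x t) j)"
  by (intro bounded_lipschitz_derivative[OF freq_deriv] bounded_gen_freq bounded_half_line_intros bounded_ac_power)
    (auto simp: gen_buses_def)

lemma lipschitz_avg_volt: "K \<in> dc_subs net \<Longrightarrow> bounded_lipschitz (\<lambda>t. avg_volt net (x t) K)"
  by (intro bounded_lipschitz_derivative[OF avg_volt_deriv] bounded_avg_volt bounded_half_line_intros bounded_dc_input)

lemma lipschitz_sync: "bounded_lipschitz (\<lambda>t. sync (x t) $ i)"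
  by (intro bounded_lipschitz_derivative[OF sync_deriv] bounded_sync bounded_half_line_divide bounded_sync_rate)

lemma lipschitz_virtual_freq: "bounded_lipschitz (\<lambda>t. virtual_freq net (x t) $ j)"
proof (cases j rule: virtual_freq_cases)
  case 1
  then show ?thesis using lipschitz_gen_freq by simp
next
  case (2 K)
  then have "bounded_lipschitz (\<lambda>t. gain net * avg_volt net (x t) K)"
    by (intro bounded_lipschitz_intros lipschitz_avg_volt)
  with 2 show ?thesis by (subst bounded_lipschitz_cong) auto
qed

lemma lipschitz_gen: "bounded_lipschitz (\<lambda>t. gen (x t) $ j)"
proof -
  have "bounded_lipschitz (\<lambda>t. cost_recip j * sync (x t) $ j)"
    by (intro bounded_lipschitz_intros lipschitz_sync)
  then show ?thesis
    by (subst bounded_lipschitz_cong) (auto simp: gen_nth[OF algebraic])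
qed

lemma lipschitz_ac_power: "j \<in> ac_buses net \<Longrightarrow> bounded_lipschitz (\<lambda>t. net_power net (x t) j)"
  unfolding ac_net_power by (intro bounded_lipschitz_intros lipschitz_gen lipschitz_angle) auto

lemma lipschitz_conv: "bounded_lipschitz (\<lambda>t. conv (x t) j)"
proof (cases j rule: conv_cases)
  case 1
  then show ?thesis by (subst bounded_lipschitz_cong[of _ "\<lambda>_. 0"]) auto
next
  case (2 i)
  then show ?thesis using lipschitz_ac_power by (subst bounded_lipschitz_cong) auto
next
  case (3 i)
  then show ?thesis using bounded_lipschitz_uminus[OF lipschitz_ac_power]
    by (subst bounded_lipschitz_cong) auto
qed

lemma lipschitz_dc_input: "bounded_lipschitz (\<lambda>t. dc_input (x t) j)"
  unfolding dc_input_def by (intro bounded_lipschitz_intros lipschitz_gen lipschitz_conv)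

lemma lipschitz_sync_rate: "bounded_lipschitz (\<lambda>t. sync_rate net (x t) $ i)"
  unfolding sync_rate_nth by (intro bounded_lipschitz_intros lipschitz_sync lipschitz_virtual_freq)

lemma lipschitz_dissipation: "bounded_lipschitz (\<lambda>t. dissipation (x t))"
  unfolding dissipation_def power2_eq_square case_prod_beta
  by (intro bounded_lipschitz_intros lipschitz_gen_freq lipschitz_sync)

section \<open>Vanishing of dissipation, frequencies and communication rates\<close>

lemma dissipation_tendsto: "((\<lambda>t. dissipation (x t)) \<longlongrightarrow> 0) at_top"
proof -
  obtain L where "(energy \<longlongrightarrow> L) at_top"
    by (rule decreasing_bounded_below_tendsto[OF lyapunov_decreasing energy_nonneg])
  then have "((\<lambda>t. - dissipation (x t)) \<longlongrightarrow> 0) at_top"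
    by (intro barbalat[OF lyapunov_deriv] slowly_varying_tendsto
        bounded_lipschitz_uminus lipschitz_dissipation)
  from tendsto_minus[OF this] show ?thesis by simp
qed

lemma gen_freq_tendsto:
  assumes "j \<in> gen_buses net" shows "((\<lambda>t. freq (x t) j) \<longlongrightarrow> 0) at_top"
proof -
  have "norm (damping net j * (freq (x t) j)\<^sup>2) \<le> dissipation (x t)" for t
  proof -
    have "damping net j * (freq (x t) j)\<^sup>2 \<le> (\<Sum>j\<in>gen_buses net. damping net j * (freq (x t) j)\<^sup>2)"
      using damping_pos by (intro member_le_sum[OF assms]) (auto simp: less_imp_le)
    moreover have "(\<Sum>(i, j)\<in>comm net. (sync (x t) $ i - sync (x t) $ j)\<^sup>2) \<ge> 0"
      by (intro sum_nonneg) auto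
    ultimately show ?thesis
      unfolding dissipation_def using damping_pos[OF assms] by simp
  qed
  then have "((\<lambda>t. damping net j * (freq (x t) j)\<^sup>2) \<longlongrightarrow> 0) at_top"
    by (intro Lim_null_comparison[OF _ dissipation_tendsto]) simp
  then show ?thesis
    using damping_pos[OF assms] tendsto_0_of_square[of "\<lambda>t. freq (x t) j"]
    by (simp add: tendsto_0_cmult_iff)
qed

lemma sync_diff_tendsto: "((\<lambda>t. sync (x t) $ i - sync (x t) $ j) \<longlongrightarrow> 0) at_top"
proof (rule connected_graph_induct[OF connected_comm,
      where P="\<lambda>i j. ((\<lambda>t. sync (x t) $ i - sync (x t) $ j) \<longlongrightarrow> 0) at_top"])
  fix i j assume ij: "(i, j) \<in> comm net"
  have "norm (1 / 2 * (sync (x t) $ i - sync (x t) $ j)\<^sup>2) \<le> dissipation (x t)" for t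
  proof -
    have "(sync (x t) $ i - sync (x t) $ j)\<^sup>2 \<le> (\<Sum>(i, j)\<in>comm net. (sync (x t) $ i - sync (x t) $ j)\<^sup>2)"
      using member_le_sum[OF ij, of "\<lambda>(i, j). (sync (x t) $ i - sync (x t) $ j)\<^sup>2"] by auto
    moreover have "(\<Sum>j\<in>gen_buses net. damping net j * (freq (x t) j)\<^sup>2) \<ge> 0"
      using damping_pos by (intro sum_nonneg) (auto simp: less_imp_le)
    ultimately show ?thesis unfolding dissipation_def by simp
  qed
  then have "((\<lambda>t. 1 / 2 * (sync (x t) $ i - sync (x t) $ j)\<^sup>2) \<longlongrightarrow> 0) at_top"
    by (intro Lim_null_comparison[OF _ dissipation_tendsto]) simp
  then have "((\<lambda>t. (sync (x t) $ i - sync (x t) $ j)\<^sup>2) \<longlongrightarrow> 0) at_top"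
    by (subst (asm) tendsto_0_cmult_iff) auto
  then show "((\<lambda>t. sync (x t) $ i - sync (x t) $ j) \<longlongrightarrow> 0) at_top"
    by (rule tendsto_0_of_square)
next
  fix i j assume "((\<lambda>t. sync (x t) $ i - sync (x t) $ j) \<longlongrightarrow> 0) at_top"
  from tendsto_minus[OF this] show "((\<lambda>t. sync (x t) $ j - sync (x t) $ i) \<longlongrightarrow> 0) at_top" by simp
next
  fix i j k
  assume "((\<lambda>t. sync (x t) $ i - sync (x t) $ j) \<longlongrightarrow> 0) at_top"
    and "((\<lambda>t. sync (x t) $ j - sync (x t) $ k) \<longlongrightarrow> 0) at_top"
  from tendsto_add[OF this] show "((\<lambda>t. sync (x t) $ i - sync (x t) $ k) \<longlongrightarrow> 0) at_top" by simp
qed auto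

lemma laplacian_tendsto:
  "((\<lambda>t. \<Sum>k | (j, k) \<in> comm net. sync (x t) $ j - sync (x t) $ k) \<longlongrightarrow> 0) at_top"
  by (intro tendsto_null_sum sync_diff_tendsto)

text \<open>
  The rates of the synchronizing variables agree asymptotically. At an AC bus with an ILC the
  rate has no frequency term and tends to zero, hence so does the frequency term everywhere.
\<close>

lemma virtual_freq_tendsto: "((\<lambda>t. virtual_freq net (x t) $ j) \<longlongrightarrow> 0) at_top"
proof (cases "x_ac net = {}")
  case True
  then have "j \<in> gen_buses net" "\<And>v. virtual_freq net v $ j = freq v j"
    using no_ilc_imp_ac[OF True, of j] by (auto simp: gen_buses_def virtual_freq_ac)
  then show ?thesis using gen_freq_tendsto by simp
next
  case False
  then obtain i where i: "i \<in> x_ac net" by auto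
  let ?r = "\<lambda>j t. sync_rate net (x t) $ j / time_const net $ j $ j"
  have not_x_ac: "((\<lambda>t. virtual_freq net (x t) $ j) \<longlongrightarrow> 0) at_top" if j: "j \<notin> x_ac net" for j
  proof -
    have "((\<lambda>t. ?r i t - ?r j t) \<longlongrightarrow> 0) at_top"
    proof (rule barbalat)
      show "((\<lambda>t. sync (x t) $ i - sync (x t) $ j) has_real_derivative ?r i t - ?r j t) (at t within {0..})"
        if "t \<ge> 0" for t by (intro DERIV_diff sync_deriv that)
    qed (intro bounded_lipschitz_intros bounded_lipschitz_divide lipschitz_sync_rate
        slowly_varying_tendsto[OF sync_diff_tendsto])+
    moreover have "((\<lambda>t. ?r i t) \<longlongrightarrow> 0) at_top"
      using tendsto_divide[OF tendsto_minus[OF laplacian_tendsto[of i]] tendsto_const, of "time_const net $ i $ i"]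
        time_const_pos[of i] by (simp add: sync_rate_nth cost_recip_x_ac[OF i])
    ultimately have "((\<lambda>t. ?r i t - (?r i t - ?r j t)) \<longlongrightarrow> 0 - 0) at_top"
      by (intro tendsto_diff)
    then have "((\<lambda>t. time_const net $ j $ j * ?r j t) \<longlongrightarrow> 0) at_top"
      by (intro tendsto_mult_right_zero) simp
    then have "((\<lambda>t. sync_rate net (x t) $ j) \<longlongrightarrow> 0) at_top"
      using time_const_pos[of j] by simp
    from tendsto_add[OF this laplacian_tendsto[of j]]
    have "((\<lambda>t. - (cost_recip j * virtual_freq net (x t) $ j)) \<longlongrightarrow> 0) at_top"
      by (simp add: sync_rate_nth)
    from tendsto_minus[OF this] show ?thesis
      using cost_recip_pos[OF j] by (simp add: tendsto_0_cmult_iff)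
  qed
  \<comment> \<open>At an AC bus with a converter the frequency term has coefficient zero in the
    rate, so its limit is taken from the DC end through the control law.\<close>
  show ?thesis
  proof (cases "j \<in> x_ac net")
    case True
    then obtain k where k: "(j, k) \<in> ilcs net" by (auto simp: x_ac_def)
    then have "k \<in> x_dc net" by (force simp: x_dc_def)
    then have "((\<lambda>t. virtual_freq net (x t) $ k) \<longlongrightarrow> 0) at_top"
      using x_disjoint by (intro not_x_ac) auto
    moreover have "\<forall>\<^sub>F t in at_top. virtual_freq net (x t) $ k = virtual_freq net (x t) $ j"
      using eventually_ge_at_top[of 0] by eventually_elim (simp add: virtual_freq_ilc[OF algebraic k])
    ultimately show ?thesis by (rule Lim_transform_eventually)
  qed (rule not_x_ac)
qed

lemma ac_freq_tendsto: "j \<in> ac_buses net \<Longrightarrow> ((\<lambda>t. freq (x t) j) \<longlongrightarrow> 0) at_top"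
  using virtual_freq_tendsto[of j] by (simp add: virtual_freq_ac)

lemma avg_volt_tendsto:
  assumes "K \<in> dc_subs net" shows "((\<lambda>t. avg_volt net (x t) K) \<longlongrightarrow> 0) at_top"
proof -
  obtain j where "j \<in> K" using assms dc_partition by (fastforce simp: partition_on_def)
  then show ?thesis
    using virtual_freq_tendsto[of j] virtual_freq_dc[OF assms, of j] gain_pos
    by (simp add: tendsto_0_cmult_iff)
qed

lemma sync_rate_tendsto: "((\<lambda>t. sync_rate net (x t) $ j) \<longlongrightarrow> 0) at_top"
  using tendsto_diff[OF tendsto_minus[OF laplacian_tendsto[of j]]
      tendsto_mult_right_zero[OF virtual_freq_tendsto[of j], of "cost_recip j"]]
  by (simp add: sync_rate_nth)

lemma gen_balance_tendsto:
  assumes "j \<in> gen_buses net"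
  shows "((\<lambda>t. net_power net (x t) j - damping net j * freq (x t) j) \<longlongrightarrow> 0) at_top"
proof -
  have "((\<lambda>t. (net_power net (x t) j - damping net j * freq (x t) j) / inertia net j) \<longlongrightarrow> 0) at_top"
  proof (rule barbalat[OF freq_deriv[OF _ assms] _ slowly_varying_tendsto[OF gen_freq_tendsto[OF assms]]])
    show "bounded_lipschitz (\<lambda>t. (net_power net (x t) j - damping net j * freq (x t) j) / inertia net j)"
      using assms
      by (intro bounded_lipschitz_divide bounded_lipschitz_intros lipschitz_ac_power lipschitz_gen_freq)
        (auto simp: gen_buses_def)
  qed
  from tendsto_mult_right_zero[OF this, of "inertia net j"] show ?thesis
    using inertia_pos[OF assms] by simp
qed

section \<open>Slow variation and the DC voltages\<close>

lemma slowly_varying_angle: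
  assumes "e \<in> ac_lines net" shows "slowly_varying (\<lambda>t. angle (x t) e)"
proof -
  obtain i j where e: "e = (i, j)" by fastforce
  have "((\<lambda>t. freq (x t) i - freq (x t) j) \<longlongrightarrow> 0 - 0) at_top"
    using ac_lineD[of i j] assms e by (intro tendsto_diff ac_freq_tendsto) auto
  then show ?thesis
    unfolding e using assms e by (intro slowly_varying_of_derivative[OF angle_deriv]) auto
qed

lemma slowly_varying_sync: "slowly_varying (\<lambda>t. sync (x t) $ i)"
proof (rule slowly_varying_of_derivative[OF sync_deriv])
  show "((\<lambda>t. sync_rate net (x t) $ i / time_const net $ i $ i) \<longlongrightarrow> 0) at_top"
    using tendsto_divide[OF sync_rate_tendsto[of i] tendsto_const, of "time_const net $ i $ i"]
      time_const_pos[of i] by simp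
qed

lemma slowly_varying_gen: "slowly_varying (\<lambda>t. gen (x t) $ j)"
proof -
  have "slowly_varying (\<lambda>t. cost_recip j * sync (x t) $ j)"
    by (intro slowly_varying_intros slowly_varying_sync)
  then show ?thesis
    by (subst slowly_varying_cong) (auto simp: gen_nth[OF algebraic])
qed

lemma slowly_varying_ac_power: "j \<in> ac_buses net \<Longrightarrow> slowly_varying (\<lambda>t. net_power net (x t) j)"
  unfolding ac_net_power by (intro slowly_varying_intros slowly_varying_gen slowly_varying_angle) auto

lemma slowly_varying_conv: "slowly_varying (\<lambda>t. conv (x t) j)"
proof (cases j rule: conv_cases)
  case 1
  then show ?thesis by (subst slowly_varying_cong[of _ "\<lambda>_. 0"]) auto
next
  case (2 i)
  then show ?thesis using slowly_varying_ac_power by (subst slowly_varying_cong) auto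
next
  case (3 i)
  then show ?thesis using slowly_varying_uminus[OF slowly_varying_ac_power]
    by (subst slowly_varying_cong) auto
qed

lemma slowly_varying_dc_input: "slowly_varying (\<lambda>t. dc_input (x t) j)"
  unfolding dc_input_def by (intro slowly_varying_intros slowly_varying_gen slowly_varying_conv)

lemma bounded_volt:
  assumes "j \<in> dc_buses net" shows "bounded_half_line (\<lambda>t. volt (x t) j)"
  by (rule dc_decay_bounded[OF volt_deriv assms bounded_dc_input])
    (auto intro: bounded_avg_volt[unfolded avg_volt_def])

text \<open>By linearity the difference between the voltages and their translate by \<open>h\<close>
  solves the same DC equation, driven by increments of the inputs. These vanish because the inputs
  vary slowly, and so do the increments of the averages; hence the difference decays although
  neither voltages nor inputs are known to converge.\<close>

lemma slowly_varying_volt: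
  assumes "j \<in> dc_buses net" shows "slowly_varying (\<lambda>t. volt (x t) j)"
  unfolding slowly_varying_def
proof (intro allI impI)
  fix h :: real assume "h > 0"
  let ?Y = "\<lambda>t j. volt (x (t + h)) j - volt (x t) j"
  let ?u = "\<lambda>t j. dc_input (x (t + h)) j - dc_input (x t) j"
  show "((\<lambda>t. ?Y t j) \<longlongrightarrow> 0) at_top"
  proof (rule dc_decay_tendsto[OF _ assms, of ?Y ?u])
    fix t :: real and i assume t: "t \<ge> 0" and i: "i \<in> dc_buses net"
    \<comment> \<open>Since \<open>t + h\<close> is positive, the derivative there is two-sided; it
      can be translated to \<open>t\<close> and then restricted to the half line again.\<close>
    have "at (t + h) within {0..} = at (t + h)"
      using t \<open>h > 0\<close> by (intro at_within_interior) simp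
    then have "((\<lambda>s. volt (x (s + h)) i) has_real_derivative
        (dc_inflow (volt (x (t + h))) i + dc_input (x (t + h)) i) / capacitance net i) (at t)"
      using volt_deriv[of "t + h" i] t i \<open>h > 0\<close> by (simp add: DERIV_shift)
    then have "((\<lambda>s. volt (x (s + h)) i) has_real_derivative
        (dc_inflow (volt (x (t + h))) i + dc_input (x (t + h)) i) / capacitance net i) (at t within {0..})"
      by (rule has_field_derivative_at_within)
    from DERIV_diff[OF this volt_deriv[OF t i]]
    show "((\<lambda>s. ?Y s i) has_real_derivative
        (dc_inflow (?Y t) i + ?u t i) / capacitance net i) (at t within {0..})"
      by (simp add: dc_inflow_diff diff_divide_distrib add_divide_distrib algebra_simps)
  next
    show "((\<lambda>t. ?u t i) \<longlongrightarrow> 0) at_top" for i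
      using slowly_varying_dc_input[of i] \<open>h > 0\<close> by (simp add: slowly_varying_def)
  next
    fix K assume "K \<in> dc_subs net"
    then have "((\<lambda>t. avg_volt net (x (t + h)) K - avg_volt net (x t) K) \<longlongrightarrow> 0) at_top"
      using slowly_varying_tendsto[OF avg_volt_tendsto] \<open>h > 0\<close> by (simp add: slowly_varying_def)
    then show "((\<lambda>t. \<Sum>j\<in>K. capacitance net j * ?Y t j) \<longlongrightarrow> 0) at_top"
      by (simp add: avg_volt_def right_diff_distrib sum_subtractf)
  qed
qed

lemma bounded_dc_inflow: "j \<in> dc_buses net \<Longrightarrow> bounded_half_line (\<lambda>t. dc_inflow (volt (x t)) j)"
  unfolding dc_inflow_def by (intro bounded_half_line_intros bounded_volt) (auto dest: dc_lineD)

lemma lipschitz_volt: "j \<in> dc_buses net \<Longrightarrow> bounded_lipschitz (\<lambda>t. volt (x t) j)"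
  by (intro bounded_lipschitz_derivative[OF volt_deriv] bounded_volt bounded_half_line_divide
      bounded_half_line_add bounded_dc_inflow bounded_dc_input)

lemma dc_balance_tendsto:
  assumes "j \<in> dc_buses net"
  shows "((\<lambda>t. net_power net (x t) j - conv (x t) j) \<longlongrightarrow> 0) at_top"
proof -
  have "bounded_lipschitz (\<lambda>t. dc_inflow (volt (x t)) j)"
    unfolding dc_inflow_def using assms
    by (intro bounded_lipschitz_intros lipschitz_volt) (auto dest: dc_lineD)
  then have "bounded_lipschitz (\<lambda>t. (dc_inflow (volt (x t)) j + dc_input (x t) j) / capacitance net j)"
    by (intro bounded_lipschitz_divide bounded_lipschitz_add lipschitz_dc_input)
  then have "((\<lambda>t. (dc_inflow (volt (x t)) j + dc_input (x t) j) / capacitance net j) \<longlongrightarrow> 0) at_top"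
    using barbalat[OF volt_deriv[OF _ assms] _ slowly_varying_volt[OF assms]] by blast
  from tendsto_mult_right_zero[OF this, of "capacitance net j"] show ?thesis
    using capacitance_pos[OF assms] by (simp add: dc_balance[OF assms])
qed

section \<open>Cluster points of a trapped solution\<close>

lemma bounded_trajectory:
  "bounded ((\<lambda>t. (state_of net (x t), \<chi> j. conv (x t) j)) ` {0..})"
proof -
  let ?a = "\<lambda>t. \<chi> e. if e \<in> ac_lines net then angle (x t) e else 0"
  let ?f = "\<lambda>t. \<chi> j. if j \<in> gen_buses net then freq (x t) j else 0"
  let ?v = "\<lambda>t. \<chi> j. if j \<in> dc_buses net then volt (x t) j else 0"
  let ?c = "\<lambda>t. \<chi> j. conv (x t) j"
  have "bounded (?a ` {0..})"
  proof (rule bounded_vec_half_line)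
    show "bounded_half_line (\<lambda>t. ?a t $ e)" for e
      using bounded_angle by (cases "e \<in> ac_lines net") auto
  qed
  moreover have "bounded (?f ` {0..})"
  proof (rule bounded_vec_half_line)
    show "bounded_half_line (\<lambda>t. ?f t $ j)" for j
      using bounded_gen_freq by (cases "j \<in> gen_buses net") auto
  qed
  moreover have "bounded (?v ` {0..})"
  proof (rule bounded_vec_half_line)
    show "bounded_half_line (\<lambda>t. ?v t $ j)" for j
      using bounded_volt by (cases "j \<in> dc_buses net") auto
  qed
  moreover have "bounded ((\<lambda>t. sync (x t)) ` {0..})"
    by (intro bounded_vec_half_line bounded_sync)
  moreover have "bounded (?c ` {0..})"
    using bounded_conv by (intro bounded_vec_half_line) simp
  ultimately have "bounded ((?a ` {0..} \<times> ?f ` {0..} \<times> ?v ` {0..} \<times> (\<lambda>t. sync (x t)) ` {0..}) \<times> ?c ` {0..})"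
    by (intro bounded_Times)
  then show ?thesis
    by (rule bounded_subset) (auto simp: state_of_def)
qed

text \<open>All relations and rates are continuous in the quantities that converge, and the rates
  tend to zero, so the limit satisfies the equilibrium equations. The converter powers accompany the
  state in the sequence because an equilibrium must supply values for them too.\<close>

lemma cluster_point_equilibrium:
  fixes s :: "nat \<Rightarrow> real"
  assumes s: "filterlim s at_top sequentially" "\<And>n. s n \<ge> 0"
    and lim: "(\<lambda>n. (state_of net (x (s n)), \<chi> j. conv (x (s n)) j)) \<longlonglongrightarrow> (z, c)"
  shows "\<exists>v. equilibrium net v \<and> state_of net v = z"
proof -
  obtain \<eta> \<omega> V \<xi> where z: "z = (\<eta>, \<omega>, V, \<xi>)" by (cases z) auto
  \<comment> \<open>Frequencies at converter buses are not part of the state; zero is the limit of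
    all AC frequencies and agrees with the control law because the averages vanish in the limit.
    Generation is recomputed from its control law.\<close>
  define v where "v = \<lparr>angle = ($) \<eta>, freq = (\<lambda>_. 0), volt = ($) V, sync = \<xi>,
    gen = cost_inv net *v \<xi>, conv = ($) c\<rparr>"
  have v: "angle v = ($) \<eta>" "freq v = (\<lambda>_. 0)" "volt v = ($) V" "sync v = \<xi>"
    "gen v = cost_inv net *v \<xi>" "conv v = ($) c"
    by (simp_all add: v_def)
  note alg = algebraic[OF s(2)]
  have state: "(\<lambda>n. state_of net (x (s n))) \<longlonglongrightarrow> z" and "(\<lambda>n. \<chi> j. conv (x (s n)) j) \<longlonglongrightarrow> c"
    using tendsto_fst[OF lim] tendsto_snd[OF lim] by simp_all
  then have conv: "(\<lambda>n. conv (x (s n)) j) \<longlonglongrightarrow> conv v j" for j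
    using tendsto_vec_nth[of "\<lambda>n. \<chi> j. conv (x (s n)) j" c sequentially j] by (simp add: v)
  note snd_state = tendsto_snd[OF state]
  have sync: "(\<lambda>n. sync (x (s n))) \<longlonglongrightarrow> sync v"
    using tendsto_snd[OF tendsto_snd[OF snd_state]] by (simp add: state_of_def z v)
  have eta: "(\<lambda>n. if e \<in> ac_lines net then angle (x (s n)) e else 0) \<longlonglongrightarrow> \<eta> $ e" for e
    using tendsto_vec_nth[OF tendsto_fst[OF state], of e] by (simp add: state_of_def z)
  have omega: "(\<lambda>n. if j \<in> gen_buses net then freq (x (s n)) j else 0) \<longlonglongrightarrow> \<omega> $ j" for j
    using tendsto_vec_nth[OF tendsto_fst[OF snd_state], of j] by (simp add: state_of_def z)
  have V: "(\<lambda>n. if j \<in> dc_buses net then volt (x (s n)) j else 0) \<longlonglongrightarrow> V $ j" for j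
    using tendsto_vec_nth[OF tendsto_fst[OF tendsto_snd[OF snd_state]], of j] by (simp add: state_of_def z)
  have angle: "(\<lambda>n. angle (x (s n)) e) \<longlonglongrightarrow> angle v e" if "e \<in> ac_lines net" for e
    using eta[of e] that by (simp add: v)
  have volt: "(\<lambda>n. volt (x (s n)) j) \<longlonglongrightarrow> volt v j" if "j \<in> dc_buses net" for j
    using V[of j] that by (simp add: v)
  have gen: "(\<lambda>n. gen (x (s n)) $ j) \<longlonglongrightarrow> gen v $ j" for j
    using tendsto_mult_left[OF tendsto_vec_nth[OF sync, of j], of "cost_recip j"]
    by (simp add: gen_nth[OF alg] v cost_inv_mult_nth)
  have flow: "(\<lambda>n. line_flow net (x (s n)) e) \<longlonglongrightarrow> line_flow net v e" if "e \<in> lines net" for e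
  proof (cases "e \<in> ac_lines net")
    case True
    then show ?thesis unfolding line_flow_def by (auto intro!: tendsto_intros angle)
  next
    case False
    then have "e \<in> dc_lines net" using that lines_split by auto
    then have "fst e \<in> dc_buses net" "snd e \<in> dc_buses net"
      using dc_lineD[of "fst e" "snd e"] by auto
    then show ?thesis using False unfolding line_flow_def by (auto intro!: tendsto_intros volt)
  qed
  have power: "(\<lambda>n. net_power net (x (s n)) j) \<longlonglongrightarrow> net_power net v j" for j
    unfolding net_power_def by (intro tendsto_intros gen flow) auto
  have avg: "(\<lambda>n. avg_volt net (x (s n)) K) \<longlonglongrightarrow> avg_volt net v K" if "K \<in> dc_subs net" for K
    unfolding avg_volt_def using dc_sub_subset[OF that] by (intro tendsto_intros volt) auto
  have avg0: "avg_volt net v K = 0" if "K \<in> dc_subs net" for K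
    using LIMSEQ_unique[OF avg[OF that] filterlim_compose[OF avg_volt_tendsto[OF that] s(1)]] .
  have vf: "virtual_freq net v = 0"
  proof -
    have "virtual_freq net v $ j = 0" for j
    proof (cases "j \<in> ac_buses net")
      case False
      then obtain K where "K \<in> dc_subs net" "j \<in> K" using not_ac_iff by (auto simp: dc_buses_def)
      then show ?thesis by (simp add: virtual_freq_dc avg0)
    qed (simp add: virtual_freq_ac v)
    then show ?thesis by (simp add: vec_eq_iff)
  qed
  have sync_rate: "sync_rate net v = 0"
  proof -
    have "sync_rate net v $ j = 0" for j
    proof -
      have "(\<lambda>n. \<Sum>k | (j, k) \<in> comm net. sync (x (s n)) $ j - sync (x (s n)) $ k) \<longlonglongrightarrow>
          (\<Sum>k | (j, k) \<in> comm net. sync v $ j - sync v $ k)"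
        by (intro tendsto_intros sync)
      with filterlim_compose[OF laplacian_tendsto s(1)]
      have "(\<Sum>k | (j, k) \<in> comm net. sync v $ j - sync v $ k) = 0"
        using LIMSEQ_unique by blast
      then show ?thesis by (simp add: sync_rate_nth vf)
    qed
    then show ?thesis by (simp add: vec_eq_iff)
  qed
  have "conv v j = 0" if "j \<notin> x_ac net \<union> x_dc net" for j
    using LIMSEQ_unique[OF conv[of j], of 0] conv_no_ilc[OF alg that] by simp
  moreover have "conv v k = - conv v i" if "(i, k) \<in> ilcs net" for i k
  proof -
    show ?thesis
      using LIMSEQ_unique[OF conv[of k]] tendsto_minus[OF conv[of i]] conv_ilc[OF alg that] by simp
  qed
  moreover have "gen v $ j = 0" if "j \<in> x_ac net" for j
    using cost_recip_x_ac[OF that] by (simp add: v cost_inv_mult_nth)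
  moreover have "0 = net_power net v j - conv v j" if "j \<in> x_ac net" for j
    using LIMSEQ_unique[OF tendsto_diff[OF power conv], of j j 0] conv_x_ac[OF alg that] by simp
  ultimately have "algebraic_relations net v"
    using avg0 unfolding algebraic_relations_def by (auto simp: v)
  moreover have "0 = net_power net v j - damping net j * freq v j" if "j \<in> gen_buses net" for j
  proof -
    have "(\<lambda>n. net_power net (x (s n)) j - damping net j * freq (x (s n)) j) \<longlonglongrightarrow>
        net_power net v j - damping net j * 0"
      by (intro tendsto_intros power filterlim_compose[OF gen_freq_tendsto[OF that] s(1)])
    with filterlim_compose[OF gen_balance_tendsto[OF that] s(1)] show ?thesis
      using LIMSEQ_unique by (simp add: v) blast
  qed
  moreover have "0 = net_power net v j - conv v j" if "j \<in> dc_buses net" for j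
    using LIMSEQ_unique[OF tendsto_diff[OF power conv] filterlim_compose[OF dc_balance_tendsto[OF that] s(1)]]
    by simp
  ultimately have "equilibrium net v"
    using sync_rate unfolding equilibrium_def by (auto simp: v)
  \<comment> \<open>The padded coordinates are zero along the sequence and therefore in the limit,
    so \<open>z\<close> is the state of an actual point; the frequency coordinates vanish by
    convergence.\<close>
  moreover have "state_of net v = z"
  proof -
    have "\<eta> $ e = 0" if "e \<notin> ac_lines net" for e
      using LIMSEQ_unique[OF eta[of e], of 0] that by simp
    moreover have "\<omega> $ j = 0" for j
    proof (cases "j \<in> gen_buses net")
      case True
      then show ?thesis
        using LIMSEQ_unique[OF omega[of j]] filterlim_compose[OF gen_freq_tendsto[OF True] s(1)] by simp
    next
      case False
      then show ?thesis using LIMSEQ_unique[OF omega[of j], of 0] by simp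
    qed
    moreover have "V $ j = 0" if "j \<notin> dc_buses net" for j
      using LIMSEQ_unique[OF V[of j], of 0] that by simp
    ultimately show ?thesis
      by (auto simp: state_of_def z v vec_eq_iff)
  qed
  ultimately show ?thesis by blast
qed

lemma tendsto_equilibria:
  "((\<lambda>t. infdist (state_of net (x t)) (state_of net ` {v. equilibrium net v})) \<longlongrightarrow> 0) at_top"
proof (rule ccontr)
  let ?d = "\<lambda>t. infdist (state_of net (x t)) (state_of net ` {v. equilibrium net v})"
  assume "\<not> (?d \<longlongrightarrow> 0) at_top"
  then obtain e where "e > 0" and e: "\<not> (\<forall>\<^sub>F t in at_top. dist (?d t) 0 < e)"
    unfolding tendsto_iff by blast
  have "\<exists>t\<ge>real n. ?d t \<ge> e" for n
    using e unfolding eventually_at_top_linorder by (auto simp: infdist_nonneg not_less)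
  \<comment> \<open>The bound \<open>real n\<close> sends the times to infinity along every
    subsequence that compactness may select.\<close>
  then obtain \<tau> where \<tau>: "\<And>n. \<tau> n \<ge> real n" "\<And>n. ?d (\<tau> n) \<ge> e" by metis
  have \<tau>_nonneg: "\<tau> n \<ge> 0" for n using \<tau>(1)[of n] by simp
  have range: "bounded (range (\<lambda>n. (state_of net (x (\<tau> n)), \<chi> j. conv (x (\<tau> n)) j)))"
    by (rule bounded_subset[OF bounded_trajectory]) (use \<tau>_nonneg in auto)
  then obtain l r where r: "strict_mono r"
    and l: "((\<lambda>n. (state_of net (x (\<tau> n)), \<chi> j. conv (x (\<tau> n)) j)) \<circ> r) \<longlonglongrightarrow> l"
    using bounded_imp_convergent_subsequence[OF range] by blast
  obtain z c where zc: "l = (z, c)" by fastforce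
  have lim: "(\<lambda>n. (state_of net (x (\<tau> (r n))), \<chi> j. conv (x (\<tau> (r n))) j)) \<longlonglongrightarrow> (z, c)"
    using l by (simp add: comp_def zc)
  have "\<tau> (r n) \<ge> real n" for n
    using \<tau>(1)[of "r n"] seq_suble[OF r, of n] by linarith
  then have "filterlim (\<lambda>n. \<tau> (r n)) at_top sequentially"
    by (rule filterlim_at_top_mono[OF filterlim_real_sequentially always_eventually[OF allI]])
  from cluster_point_equilibrium[OF this \<tau>_nonneg lim]
  obtain v where v: "equilibrium net v" "state_of net v = z" by blast
  have "(\<lambda>n. state_of net (x (\<tau> (r n)))) \<longlonglongrightarrow> z"
    using tendsto_fst[OF lim] by simp
  then have "(\<lambda>n. dist (state_of net (x (\<tau> (r n)))) z) \<longlonglongrightarrow> 0"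
    by (rule tendsto_dist_iff[THEN iffD1])
  then have "\<forall>\<^sub>F n in sequentially. dist (state_of net (x (\<tau> (r n)))) z < e"
    using \<open>e > 0\<close> by (rule order_tendstoD(2))
  then obtain n where "dist (state_of net (x (\<tau> (r n)))) z < e"
    by (auto simp: eventually_sequentially)
  moreover have "?d (\<tau> (r n)) \<le> dist (state_of net (x (\<tau> (r n)))) z"
    using v by (intro infdist_le) auto
  ultimately show False using \<tau>(2)[of "r n"] by simp
qed

end

theorem theorem4:
  fixes net :: "('n::finite) network" and vs :: "'n point"
  assumes "hybrid_network net"
    and "equilibrium net vs"
    and "\<forall>e\<in>ac_lines net. \<bar>angle vs e\<bar> < pi / 2"
  shows "\<exists>U S. openin (top_of_set (state_space net)) U \<and> state_of net vs \<in> U \<and>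
    S \<noteq> {} \<and>
    (\<forall>v\<in>S. equilibrium net v \<and>
       (\<forall>j\<in>ac_buses net. freq v j = 0) \<and>
       (\<forall>K\<in>dc_subs net. avg_volt net v K = 0) \<and>
       optimal_power_sharing net (freq v) (gen v)) \<and>
    (\<forall>x. closed_loop_solution net x \<and> state_of net (x 0) \<in> U \<longrightarrow>
       ((\<lambda>t. infdist (state_of net (x t)) (state_of net ` S)) \<longlongrightarrow> 0) at_top)"
proof -
  interpret hybrid_grid net by standard (rule assms(1))
  \<comment> \<open>Half the smallest distance of an equilibrium angle to \<open>pi / 2\<close>, so
    that the closed strip of width \<open>d\<close> stays inside; the inserted 1 covers a network
    without AC lines.\<close>
  define d where "d = Min (insert 1 ((\<lambda>e. (pi / 2 - \<bar>angle vs e\<bar>) / 2) ` ac_lines net))"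
  have "d > 0" unfolding d_def using assms(3) by simp
  have margin: "\<bar>angle vs e\<bar> + d < pi / 2" if "e \<in> ac_lines net" for e
  proof -
    have "d \<le> (pi / 2 - \<bar>angle vs e\<bar>) / 2" unfolding d_def using that by (intro Min_le) auto
    then show ?thesis using assms(3) that by force
  qed
  let ?barrier = "\<lambda>e y. susceptance net e * angle_potential (angle vs e) y"
  \<comment> \<open>The boundary of each strip consists of the two angles at distance
    \<open>d\<close>, so the height of the barrier is a minimum of finitely many values; the
    inserted 1 again keeps the set nonempty.\<close>
  define c where "c = Min (insert 1 ((\<lambda>e. min (?barrier e (angle vs e - d)) (?barrier e (angle vs e + d))) ` ac_lines net))"
  have "?barrier e y > 0" if "e \<in> ac_lines net" "\<bar>y - angle vs e\<bar> = d" for e y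
    using margin[OF that(1)] that(2) assms(3) \<open>d > 0\<close>
    by (intro mult_pos_pos susceptance_pos[OF that(1)] angle_potential_pos) auto
  then have "c > 0" unfolding c_def using \<open>d > 0\<close> by simp
  have c: "c \<le> ?barrier e y" if "e \<in> ac_lines net" "\<bar>y - angle vs e\<bar> = d" for e y
  proof -
    have "c \<le> min (?barrier e (angle vs e - d)) (?barrier e (angle vs e + d))"
      unfolding c_def using that(1) by (intro Min_le) auto
    moreover have "y = angle vs e - d \<or> y = angle vs e + d" using that(2) by linarith
    ultimately show ?thesis by auto
  qed
  \<comment> \<open>The angle bound is imposed in addition to the energy bound because a sublevel
    set alone is no well: away from the strip \<open>angle_potential\<close> can return to zero or
    become negative.\<close>
  define W where "W = {z :: 'n state. lyapunov vs z < c} \<inter>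
    (\<Inter>e\<in>ac_lines net. {z. \<bar>fst z $ e - angle vs e\<bar> < d})"
  have "open W"
    unfolding W_def by (intro open_Int open_INT ballI open_Collect_less continuous_intros continuous_lyapunov) auto
  then have "openin (top_of_set (state_space net)) (state_space net \<inter> W)"
    by (rule openin_open_Int)
  moreover have "state_of net vs \<in> state_space net \<inter> W"
    using \<open>c > 0\<close> \<open>d > 0\<close> lyapunov_equilibrium[OF assms(2)]
    by (auto simp: W_def state_space_def state_of_def)
  moreover have "((\<lambda>t. infdist (state_of net (x t)) (state_of net ` {v. equilibrium net v})) \<longlongrightarrow> 0) at_top"
    if x: "closed_loop_solution net x" "state_of net (x 0) \<in> state_space net \<inter> W" for x
  proof -
    interpret closed_loop net vs x by standard (use assms(2) x(1) in auto)
    have init: "\<bar>angle (x 0) e - angle vs e\<bar> < d" if "e \<in> ac_lines net" for e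
      using x(2) that by (auto simp: W_def state_of_def dest!: bspec)
    have level: "lyapunov vs (state_of net (x 0)) < c" using x(2) by (simp add: W_def)
    interpret trapped_solution net vs x d
    proof unfold_locales
      show "\<bar>angle vs e\<bar> + d < pi / 2" if "e \<in> ac_lines net" for e using that by (rule margin)
      show "\<bar>angle (x t) e - angle vs e\<bar> < d" if "t \<ge> 0" "e \<in> ac_lines net" for t e
        using trapped[OF margin c init level that] .
    qed
    show ?thesis by (rule tendsto_equilibria)
  qed
  \<comment> \<open>The limit set is the set of all equilibria: it contains \<open>vs\<close>, and
    each member has vanishing deviations and optimal generation.\<close>
  ultimately show ?thesis
    using assms(2) equilibrium_freq equilibrium_avg_volt equilibrium_optimal
    by (intro exI[of _ "state_space net \<inter> W"] exI[of _ "{v. equilibrium net v}"]) auto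
qed

end
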